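(* For any $\epsilon\in(0,1)$, there is an algorithm which, given the number of customers $T\ge1$ and a universe $\mathcal{N}=\{1,\dots,n\}$ of products with preference weights $v_1,\dots,v_n>0$, computes an assortment $S\subseteq\mathcal{N}$ with $$\mathbb{E}(M(S))\ \ge\ (1-\epsilon)\cdot\max_{S'\subseteq\mathcal{N}}\mathbb{E}(M(S')),$$ and whose running time is $O\big(T^{O(1)}\cdot n^{O(\frac1\epsilon\log\frac1\epsilon)}\big)$.
   Context: Multinomial Logit (MNL) model: each product $i\in\mathcal{N}$ has preference weight $v_i>0$ and the no-purchase option $0$ has weight $1$. For an assortment $S\subseteq\mathcal{N}$ let $v(S)=\sum_{i\in S}v_i$, $\phi_i(S)=\frac{v_i}{1+v(S)}$ for $i\in S$, and $\phi_0(S)=\frac{1}{1+v(S)}$. When $S$ is offered to $T$ customers, each customer independently chooses option $i\in S\cup\{0\}$ with probability $\phi_i(S)$. The load $L_i(S)$ is the (random) number of customers choosing product $i$, and $M(S)=\max_{i\in S}L_i(S)$ (with $M(\emptyset)=0$). Running time is the number of elementary arithmetic operations. The $O(\cdot)$ in the exponent of $n$ is asymptotic as $\epsilon\to0$, i.e. it denotes a quantity bounded by $C\,(1+\frac1\epsilon\log\frac1\epsilon)$ for an absolute constant $C$. *)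

theory Defs
  imports "HOL-Probability.Probability"
begin

section \<open>The Multinomial Logit model and the expected maximum load\<close>

text \<open>
  Products are positive natural numbers and option 0 is the no-purchase option, so an
  assortment is a finite set \<open>S\<close> with \<open>0 \<notin> S\<close>.
\<close>

definition total_weight :: "(nat \<Rightarrow> real) \<Rightarrow> nat set \<Rightarrow> real" where
  "total_weight v S = (\<Sum>i\<in>S. v i)"

definition choice_prob :: "(nat \<Rightarrow> real) \<Rightarrow> nat set \<Rightarrow> nat \<Rightarrow> real" where
  "choice_prob v S i =
     (if i = 0 then 1 / (1 + total_weight v S)
      else if i \<in> S then v i / (1 + total_weight v S)
      else 0)"

text \<open>
  \<open>embed_pmf\<close> is only meaningful for a genuine probability mass function; the lemma
  \<open>pmf_mnl_choice\<close> shows that it is one for positive weights.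
\<close>

definition mnl_choice :: "(nat \<Rightarrow> real) \<Rightarrow> nat set \<Rightarrow> nat pmf" where
  "mnl_choice v S = embed_pmf (choice_prob v S)"

lemma pmf_mnl_choice:
  assumes "finite S" "0 \<notin> S" "\<And>i. i \<in> S \<Longrightarrow> 0 < v i"
  shows "pmf (mnl_choice v S) i = choice_prob v S i"
proof -
  have pos: "0 \<le> total_weight v S"
    unfolding total_weight_def using assms(3) by (intro sum_nonneg) (auto intro: less_imp_le)
  have nonneg: "0 \<le> choice_prob v S j" for j
    using pos assms(3)[of j] by (auto simp: choice_prob_def)
  have eq: "choice_prob v S j = v j / (1 + total_weight v S)" if "j \<in> S" for j
    using that assms(2) by (auto simp: choice_prob_def)
  have "(\<Sum>j\<in>S. choice_prob v S j) = total_weight v S / (1 + total_weight v S)"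
    by (simp add: eq total_weight_def sum_divide_distrib)
  hence one: "(\<Sum>j\<in>insert 0 S. choice_prob v S j) = 1"
    using assms(1,2) pos by (simp add: choice_prob_def[of v S 0] flip: add_divide_distrib)
  have "(\<integral>\<^sup>+ j. ennreal (choice_prob v S j) \<partial>count_space UNIV)
        = (\<Sum>j\<in>insert 0 S. ennreal (choice_prob v S j))"
    using assms(1) by (intro nn_integral_count_space') (auto simp: choice_prob_def)
  also have "\<dots> = 1"
    using one nonneg by (subst sum_ennreal) auto
  finally show ?thesis
    unfolding mnl_choice_def using nonneg by (intro pmf_embed_pmf) auto
qed

text \<open>
  A joint outcome \<open>\<omega>\<close> assigns to each customer \<open>t < T\<close> the option \<open>\<omega> t\<close>; the value 0
  outside \<open>{..<T}\<close> is the default required by \<open>Pi_pmf\<close>.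
\<close>

definition customers :: "nat \<Rightarrow> (nat \<Rightarrow> real) \<Rightarrow> nat set \<Rightarrow> (nat \<Rightarrow> nat) pmf" where
  "customers T v S = Pi_pmf {..<T} 0 (\<lambda>_. mnl_choice v S)"

definition load :: "nat \<Rightarrow> (nat \<Rightarrow> nat) \<Rightarrow> nat \<Rightarrow> nat" where
  "load T \<omega> i = card {t. t < T \<and> \<omega> t = i}"

definition max_load :: "nat \<Rightarrow> nat set \<Rightarrow> (nat \<Rightarrow> nat) \<Rightarrow> nat" where
  "max_load T S \<omega> = (if S = {} then 0 else Max (load T \<omega> ` S))"

definition expected_max_load :: "nat \<Rightarrow> (nat \<Rightarrow> real) \<Rightarrow> nat set \<Rightarrow> real" where
  "expected_max_load T v S =
     measure_pmf.expectation (customers T v S) (\<lambda>\<omega>. real (max_load T S \<omega>))"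


section \<open>Algorithms: while programs over natural numbers and reals\<close>

text \<open>
  The model is the real RAM with unit-cost arithmetic, presented as a while language. The
  memory consists of two-sorted arrays, with natural numbers and with reals as entries; a
  scalar is an array that is used at index 0 only. Programs contain no real constants, and
  there is no way to go from reals to naturals other than comparison (no floor) and no integer
  division. Hence a program can neither carry nonuniform advice in a real constant nor use
  long numbers for parallel bit manipulation. Division of reals by zero yields 0, as in HOL.
\<close>

datatype nexp =
    NConst nat
  | NGet string nexp
  | NAdd nexp nexp
  | NSub nexp nexp
  | NMul nexp nexp

datatype rexp =
    ROfNat nexp
  | RGet string nexp
  | RAdd rexp rexp
  | RSub rexp rexp
  | RMul rexp rexp
  | RDiv rexp rexp

datatype bexp =
    NLess nexp nexp
  | RLess rexp rexp
  | BNot bexp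
  | BAnd bexp bexp

datatype com =
    Skip
  | NSet string nexp nexp   (* NSet a i e  is  a[i] := e *)
  | RSet string nexp rexp
  | Seq com com
  | Cond bexp com com
  | While bexp com

record memory =
  nmem :: "string \<Rightarrow> nat \<Rightarrow> nat"
  rmem :: "string \<Rightarrow> nat \<Rightarrow> real"

fun nval :: "memory \<Rightarrow> nexp \<Rightarrow> nat" where
  "nval s (NConst k) = k"
| "nval s (NGet a i) = nmem s a (nval s i)"
| "nval s (NAdd e f) = nval s e + nval s f"
| "nval s (NSub e f) = nval s e - nval s f"
| "nval s (NMul e f) = nval s e * nval s f"

fun rval :: "memory \<Rightarrow> rexp \<Rightarrow> real" where
  "rval s (ROfNat e) = real (nval s e)"
| "rval s (RGet a i) = rmem s a (nval s i)"
| "rval s (RAdd e f) = rval s e + rval s f"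
| "rval s (RSub e f) = rval s e - rval s f"
| "rval s (RMul e f) = rval s e * rval s f"
| "rval s (RDiv e f) = rval s e / rval s f"

fun bval :: "memory \<Rightarrow> bexp \<Rightarrow> bool" where
  "bval s (NLess e f) = (nval s e < nval s f)"
| "bval s (RLess e f) = (rval s e < rval s f)"
| "bval s (BNot b) = (\<not> bval s b)"
| "bval s (BAnd b c) = (bval s b \<and> bval s c)"

text \<open>The cost of an expression is the number of its nodes: every operation, memory access
  and constant is charged one unit.\<close>

fun ncost :: "nexp \<Rightarrow> nat" where
  "ncost (NConst k) = 1"
| "ncost (NGet a i) = 1 + ncost i"
| "ncost (NAdd e f) = 1 + ncost e + ncost f"
| "ncost (NSub e f) = 1 + ncost e + ncost f"
| "ncost (NMul e f) = 1 + ncost e + ncost f"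

fun rcost :: "rexp \<Rightarrow> nat" where
  "rcost (ROfNat e) = 1 + ncost e"
| "rcost (RGet a i) = 1 + ncost i"
| "rcost (RAdd e f) = 1 + rcost e + rcost f"
| "rcost (RSub e f) = 1 + rcost e + rcost f"
| "rcost (RMul e f) = 1 + rcost e + rcost f"
| "rcost (RDiv e f) = 1 + rcost e + rcost f"

fun bcost :: "bexp \<Rightarrow> nat" where
  "bcost (NLess e f) = 1 + ncost e + ncost f"
| "bcost (RLess e f) = 1 + rcost e + rcost f"
| "bcost (BNot b) = 1 + bcost b"
| "bcost (BAnd b c) = 1 + bcost b + bcost c"

definition nupdate :: "string \<Rightarrow> nat \<Rightarrow> nat \<Rightarrow> memory \<Rightarrow> memory" where
  "nupdate a i x s = s\<lparr>nmem := (nmem s)(a := (nmem s a)(i := x))\<rparr>"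

definition rupdate :: "string \<Rightarrow> nat \<Rightarrow> real \<Rightarrow> memory \<Rightarrow> memory" where
  "rupdate a i x s = s\<lparr>rmem := (rmem s)(a := (rmem s a)(i := x))\<rparr>"

text \<open>\<open>exec P s t s'\<close>: started in memory \<open>s\<close>, the program \<open>P\<close> terminates in memory \<open>s'\<close>
  after \<open>t\<close> elementary operations.\<close>

inductive exec :: "com \<Rightarrow> memory \<Rightarrow> nat \<Rightarrow> memory \<Rightarrow> bool" where
  Skip: "exec Skip s 1 s"
| NSet: "exec (NSet a i e) s (1 + ncost i + ncost e) (nupdate a (nval s i) (nval s e) s)"
| RSet: "exec (RSet a i e) s (1 + ncost i + rcost e) (rupdate a (nval s i) (rval s e) s)"
| Seq: "exec P s t s' \<Longrightarrow> exec Q s' u s'' \<Longrightarrow> exec (Seq P Q) s (t + u) s''"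
| CondTrue: "bval s b \<Longrightarrow> exec P s t s' \<Longrightarrow> exec (Cond b P Q) s (1 + bcost b + t) s'"
| CondFalse: "\<not> bval s b \<Longrightarrow> exec Q s t s' \<Longrightarrow> exec (Cond b P Q) s (1 + bcost b + t) s'"
| WhileFalse: "\<not> bval s b \<Longrightarrow> exec (While b P) s (1 + bcost b) s"
| WhileTrue: "bval s b \<Longrightarrow> exec P s t s' \<Longrightarrow> exec (While b P) s' u s'' \<Longrightarrow>
    exec (While b P) s (1 + bcost b + t + u) s''"

inductive_cases exec_SkipE: "exec Skip s t s'"
  and exec_NSetE: "exec (NSet a i e) s t s'"
  and exec_RSetE: "exec (RSet a i e) s t s'"
  and exec_SeqE: "exec (Seq P Q) s t s'"
  and exec_CondE: "exec (Cond b P Q) s t s'"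
  and exec_WhileE: "exec (While b P) s t s'"

lemma exec_deterministic:
  "exec P s t s' \<Longrightarrow> exec P s u r \<Longrightarrow> u = t \<and> r = s'"
proof (induction arbitrary: u r rule: exec.induct)
  case (Skip s)
  from Skip.prems show ?case by (rule exec_SkipE) simp
next
  case (NSet a i e s)
  from NSet.prems show ?case by (rule exec_NSetE) simp
next
  case (RSet a i e s)
  from RSet.prems show ?case by (rule exec_RSetE) simp
next
  case (Seq P s t\<^sub>1 s\<^sub>1 Q t\<^sub>2 s\<^sub>2)
  from Seq.prems show ?case by (rule exec_SeqE) (metis Seq.IH)
next
  case (CondTrue s b P t\<^sub>1 s\<^sub>1 Q)
  from CondTrue.prems show ?case by (rule exec_CondE) (use CondTrue.IH CondTrue.hyps in fastforce)+
next
  case (CondFalse s b Q t\<^sub>1 s\<^sub>1 P)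
  from CondFalse.prems show ?case by (rule exec_CondE) (use CondFalse.IH CondFalse.hyps in fastforce)+
next
  case (WhileFalse s b P)
  from WhileFalse.prems show ?case by (rule exec_WhileE) (use WhileFalse.hyps in simp_all)
next
  case (WhileTrue s b P t\<^sub>1 s\<^sub>1 t\<^sub>2 s\<^sub>2)
  from WhileTrue.prems show ?case
  proof (rule exec_WhileE)
    assume "\<not> bval s b"
    with WhileTrue.hyps show ?thesis by simp
  next
    fix t' s' u'
    assume u: "u = Suc (bcost b + t' + u')"
      and body: "exec P s t' s'" and rest: "exec (While b P) s' u' r"
    from WhileTrue.IH(1)[OF body] have "t' = t\<^sub>1" "s' = s\<^sub>1" by simp_all
    with WhileTrue.IH(2)[of u' r] rest u show ?thesis by simp
  qed
qed

text \<open>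
  The input consists of the scalars \<open>T\<close>, \<open>n\<close> and the entries 1 to \<open>n\<close> of the real array
  \<open>v\<close>; all other memory is zero. The output is the set of those products whose entry in the
  array \<open>S\<close> of naturals is nonzero.
\<close>

definition input_memory :: "nat \<Rightarrow> nat \<Rightarrow> (nat \<Rightarrow> real) \<Rightarrow> memory" where
  "input_memory T n v =
     \<lparr>nmem = (\<lambda>a i. if a = ''T'' \<and> i = 0 then T else if a = ''n'' \<and> i = 0 then n else 0),
      rmem = (\<lambda>a i. if a = ''v'' \<and> i \<in> {1..n} then v i else 0)\<rparr>"

definition output_assortment :: "nat \<Rightarrow> memory \<Rightarrow> nat set" where
  "output_assortment n s = {i \<in> {1..n}. nmem s ''S'' i \<noteq> 0}"

end

theory Submission imports Defs begin

text \<open>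
  The algorithm tries all assortments that are unions of \<open>O(1/\<epsilon> log 1/\<epsilon>)\<close> segments of the products
  ordered by decreasing weight, computes the expected maximum load of each of them exactly and
  keeps the best. Two things have to be explained: why some such assortment is nearly optimal, and
  how an expected maximum load is computed with polynomially many arithmetic operations.

  Near-optimality rests on two comparisons of expected maximum loads. If all purchase probabilities
  shrink by a factor \<open>c\<close>, the expectation shrinks by at most \<open>c\<close>
  (\<open>arrive_thinning\<close>). If purchase probability is moved from a less popular to a more popular
  product, the expectation does not decrease (\<open>arrive_transfer\<close>); consequently a vector of
  probabilities may be replaced by one that majorizes it (\<open>mean_peak_majorized\<close>). Now take an optimal
  assortment and divide the products into classes, with weights in the ratio \<open>1 - \<epsilon>/2\<close>, starting
  from the heaviest product in it. After \<open>O(1/\<epsilon> log 1/\<epsilon>)\<close> classes the weights are at most \<open>\<epsilon>/2\<close>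
  times the heaviest, and all that remain form one last class. In each class replace the products
  used by the heaviest ones of that class, as few as suffice to reach the same total weight. The
  new weights majorize the old ones, and the total weight grows only slightly: within a class of
  nearly equal weights the number of products does not grow, and in the last class the overshoot
  is less than one light product
  (\<open>near_optimal_class_prefixes\<close>). The new assortment consists of at most one
  segment per class, so there are \<open>n\<close> to the power \<open>O(1/\<epsilon> log 1/\<epsilon>)\<close> candidates, given by the endpoints
  of their segments.

  For the evaluation, the expected maximum is the sum over \<open>k\<close> of the probability that
  some load exceeds \<open>k\<close>, and the probability that no load exceeds \<open>k\<close> is, up to the factor \<open>T!\<close>, the
  coefficient of degree \<open>T\<close> in a product of an exponential series and truncated exponential series
  (\<open>expected_max_load_formula\<close>). The program multiplies these series up to degree \<open>T\<close>.
  Its correctness and running time are derived together, in a calculus of triples with step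
  bounds whose central rule is \<open>runs_For_general\<close>.
\<close>

section \<open>Expected peak load of a sequence of customers\<close>

text \<open>
  Option 0 (no purchase) never enters the maximum, so it is enough to know the distribution of a
  customer on a set \<open>I\<close> of products; the missing mass means that nobody's load changes. Customers
  are given as a list of possibly different distributions, because the comparisons below change
  them one at a time. Loads are real numbers: the thinning lemma evaluates the same process from
  fractional starting loads.
\<close>

definition bump :: "nat \<Rightarrow> (nat \<Rightarrow> real) \<Rightarrow> nat \<Rightarrow> real" where
  "bump i l = l(i := l i + 1)"

primrec arrive :: "nat set \<Rightarrow> ((nat \<Rightarrow> real) \<Rightarrow> real) \<Rightarrow> (nat \<Rightarrow> real) list \<Rightarrow> (nat \<Rightarrow> real) \<Rightarrow> real" where
  "arrive I h [] l = h l"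
| "arrive I h (p # ps) l =
     (1 - (\<Sum>i\<in>I. p i)) * arrive I h ps l + (\<Sum>i\<in>I. p i * arrive I h ps (bump i l))"

definition subprob :: "nat set \<Rightarrow> (nat \<Rightarrow> real) \<Rightarrow> bool" where
  "subprob I p \<longleftrightarrow> (\<forall>i\<in>I. 0 \<le> p i) \<and> sum p I \<le> 1"

definition peak :: "nat set \<Rightarrow> (nat \<Rightarrow> real) \<Rightarrow> real" where
  "peak I l = Max (l ` I)"

lemma bump_commute: "bump i (bump j l) = bump j (bump i l)"
  by (auto simp: bump_def fun_eq_iff)

lemma arrive_swap: "arrive I h (p # q # ps) l = arrive I h (q # p # ps) l"
proof -
  define G where "G = arrive I h ps"
  have "(\<Sum>i\<in>I. p i * (\<Sum>j\<in>I. q j * G (bump j (bump i l))))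
      = (\<Sum>i\<in>I. \<Sum>j\<in>I. p i * (q j * G (bump j (bump i l))))"
    by (simp add: sum_distrib_left)
  also have "\<dots> = (\<Sum>j\<in>I. \<Sum>i\<in>I. p i * (q j * G (bump j (bump i l))))"
    by (rule sum.swap)
  also have "\<dots> = (\<Sum>j\<in>I. q j * (\<Sum>i\<in>I. p i * G (bump i (bump j l))))"
    by (simp add: sum_distrib_left mult.left_commute bump_commute)
  finally have *: "(\<Sum>i\<in>I. p i * (\<Sum>j\<in>I. q j * G (bump j (bump i l))))
     = (\<Sum>j\<in>I. q j * (\<Sum>i\<in>I. p i * G (bump i (bump j l))))" .
  have **: "(\<Sum>i\<in>I. r i * (c * G (bump i l))) = c * (\<Sum>i\<in>I. r i * G (bump i l))"
    for c and r :: "nat \<Rightarrow> real"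
    by (simp add: sum_distrib_left mult.left_commute)
  show ?thesis
    by (simp add: * ** sum.distrib distrib_left flip: G_def)
qed

lemma arrive_cong_tail:
  "(\<And>l. arrive I h ps l = arrive I h qs l) \<Longrightarrow> arrive I h (p # ps) l = arrive I h (p # qs) l"
  by simp

text \<open>
  The customers are independent and only the final loads matter, so their order is irrelevant.
\<close>

lemma arrive_middle: "arrive I h (ps @ p # qs) l = arrive I h (p # ps @ qs) l"
proof (induction ps arbitrary: l)
  case (Cons q ps)
  have "arrive I h (q # (ps @ p # qs)) l = arrive I h (q # p # ps @ qs) l"
    by (rule arrive_cong_tail) (rule Cons.IH)
  then show ?case by (simp only: append_Cons arrive_swap[of I h q p])
qed simp

lemma peak_mono:
  assumes "finite I" "I \<noteq> {}" "\<And>i. i \<in> I \<Longrightarrow> l i \<le> l' i"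
  shows "peak I l \<le> peak I l'"
proof -
  have "l i \<le> Max (l' ` I)" if "i \<in> I" for i
    using assms(3)[OF that] that assms(1) by (meson Max_ge finite_imageI imageI order_trans)
  then show ?thesis using assms by (auto simp: peak_def)
qed

lemma peak_convex:
  assumes "finite I" "I \<noteq> {}" "0 \<le> a" "a \<le> 1"
  shows "peak I (\<lambda>i. a * x i + (1 - a) * y i) \<le> a * peak I x + (1 - a) * peak I y"
proof -
  have "a * x i + (1 - a) * y i \<le> a * Max (x ` I) + (1 - a) * Max (y ` I)" if "i \<in> I" for i
    using that assms by (intro add_mono mult_left_mono) auto
  then show ?thesis using assms by (auto simp: peak_def)
qed

lemma arrive_mono:
  assumes "finite I" "I \<noteq> {}" "\<And>p. p \<in> set ps \<Longrightarrow> subprob I p" "\<And>i. l i \<le> l' i"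
  shows "arrive I (peak I) ps l \<le> arrive I (peak I) ps l'"
  using assms(3,4)
proof (induction ps arbitrary: l l')
  case Nil
  then show ?case using peak_mono[OF assms(1,2)] by simp
next
  case (Cons p ps)
  have IH: "arrive I (peak I) ps l \<le> arrive I (peak I) ps l'" if "\<And>i. l i \<le> l' i" for l l'
    using Cons.IH Cons.prems that by auto
  have "subprob I p" using Cons.prems by auto
  then show ?case using IH Cons.prems(2)
    by (auto simp: subprob_def bump_def intro!: add_mono mult_left_mono sum_mono)
qed

text \<open>
  A maximum of linear functions is convex, and averaging over arrivals preserves convexity.
\<close>

lemma arrive_convex:
  assumes "finite I" "I \<noteq> {}" "\<And>p. p \<in> set ps \<Longrightarrow> subprob I p" "0 \<le> a" "a \<le> 1"
  shows "arrive I (peak I) ps (\<lambda>i. a * x i + (1 - a) * y i)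
       \<le> a * arrive I (peak I) ps x + (1 - a) * arrive I (peak I) ps y"
  using assms(3)
proof (induction ps arbitrary: x y)
  case Nil
  then show ?case using peak_convex[OF assms(1,2,4,5)] by simp
next
  case (Cons p ps)
  let ?G = "arrive I (peak I) ps"
  have IH: "?G (\<lambda>i. a * x i + (1 - a) * y i) \<le> a * ?G x + (1 - a) * ?G y" for x y
    using Cons.IH Cons.prems by auto
  have b: "bump j (\<lambda>i. a * x i + (1 - a) * y i) = (\<lambda>i. a * bump j x i + (1 - a) * bump j y i)" for j
    by (auto simp: bump_def fun_eq_iff algebra_simps)
  have sp: "subprob I p" using Cons.prems by auto
  have "arrive I (peak I) (p # ps) (\<lambda>i. a * x i + (1 - a) * y i)
     \<le> (1 - sum p I) * (a * ?G x + (1 - a) * ?G y)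
       + (\<Sum>i\<in>I. p i * (a * ?G (bump i x) + (1 - a) * ?G (bump i y)))"
    using sp IH by (auto simp: b subprob_def intro!: add_mono mult_left_mono sum_mono)
  also have "(\<Sum>i\<in>I. p i * (a * ?G (bump i x) + (1 - a) * ?G (bump i y)))
     = a * (\<Sum>i\<in>I. p i * ?G (bump i x)) + (1 - a) * (\<Sum>i\<in>I. p i * ?G (bump i y))"
    by (simp add: sum.distrib distrib_left mult.left_commute sum_distrib_left)
  also have "(1 - sum p I) * (a * ?G x + (1 - a) * ?G y) + \<dots>
     = a * arrive I (peak I) (p # ps) x + (1 - a) * arrive I (peak I) (p # ps) y"
    by (simp add: algebra_simps)
  finally show ?case .
qed

lemma subprob_scale:
  assumes "subprob I p" "0 \<le> c" "c \<le> 1"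
  shows "subprob I (\<lambda>i. c * p i)"
  using assms by (auto simp: subprob_def simp flip: sum_distrib_left intro!: mult_le_one sum_nonneg)

section \<open>Thinning the stream of customers\<close>

text \<open>
  Scaling all purchase probabilities by \<open>c\<close> costs at most the factor \<open>c\<close>, independently of the number
  of customers. The reason is Jensen's inequality: letting a customer count fully with probability
  \<open>c\<close> and not at all otherwise is, by convexity in the starting loads, at least as good as letting
  the customer always count with weight \<open>c\<close>; and if everybody counts with weight \<open>c\<close>, the peak is
  multiplied by \<open>c\<close>.
\<close>

lemma arrive_thinning:
  assumes "finite I" "I \<noteq> {}" "subprob I p" "0 \<le> c" "c \<le> 1"
  shows "c * arrive I (peak I) (replicate T p) l
    \<le> arrive I (peak I) (replicate T (\<lambda>i. c * p i)) (\<lambda>i. c * l i)"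
proof (induction T arbitrary: l)
  case 0
  have "c * Max (l ` I) = Max ((\<lambda>i. c * l i) ` I)"
    using mono_Max_commute[of "\<lambda>z. c * z" "l ` I"] assms
    by (auto simp: mono_def mult_left_mono image_image)
  then show ?case by (simp add: peak_def)
next
  case (Suc T)
  let ?G = "arrive I (peak I) (replicate T p)"
  let ?H = "arrive I (peak I) (replicate T (\<lambda>i. c * p i))"
  have pn: "0 \<le> p i" if "i \<in> I" for i using assms that by (auto simp: subprob_def)
  have step: "c * ?G (bump i l) \<le> c * ?H (bump i (\<lambda>i. c * l i)) + (1 - c) * ?H (\<lambda>i. c * l i)" for i
  proof -
    have eq: "(\<lambda>j. c * bump i l j) = (\<lambda>j. c * bump i (\<lambda>i. c * l i) j + (1 - c) * (c * l j))"
      by (auto simp: bump_def fun_eq_iff algebra_simps)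
    have "c * ?G (bump i l) \<le> ?H (\<lambda>j. c * bump i l j)" by (rule Suc.IH)
    also have "\<dots> \<le> c * ?H (bump i (\<lambda>i. c * l i)) + (1 - c) * ?H (\<lambda>i. c * l i)"
      unfolding eq using assms subprob_scale[OF assms(3-5)] by (intro arrive_convex) auto
    finally show ?thesis .
  qed
  have "c * arrive I (peak I) (replicate (Suc T) p) l
      = (1 - sum p I) * (c * ?G l) + (\<Sum>i\<in>I. p i * (c * ?G (bump i l)))"
    by (simp add: distrib_left sum_distrib_left mult.left_commute)
  also have "\<dots> \<le> (1 - sum p I) * ?H (\<lambda>i. c * l i)
      + (\<Sum>i\<in>I. p i * (c * ?H (bump i (\<lambda>i. c * l i)) + (1 - c) * ?H (\<lambda>i. c * l i)))"
    using assms(3) Suc.IH step by (intro add_mono mult_left_mono sum_mono) (auto simp: subprob_def)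
  also have "(\<Sum>i\<in>I. p i * (c * ?H (bump i (\<lambda>i. c * l i)) + (1 - c) * ?H (\<lambda>i. c * l i)))
     = (\<Sum>i\<in>I. c * p i * ?H (bump i (\<lambda>i. c * l i))) + sum p I * ((1 - c) * ?H (\<lambda>i. c * l i))"
    by (simp add: distrib_left sum.distrib sum_distrib_right sum_distrib_left mult_ac)
  also have "(1 - sum p I) * ?H (\<lambda>i. c * l i) + \<dots>
     = arrive I (peak I) (replicate (Suc T) (\<lambda>i. c * p i)) (\<lambda>i. c * l i)"
    by (simp add: algebra_simps flip: sum_distrib_left)
  finally show ?case .
qed

section \<open>Shifting purchase probability towards the more popular product\<close>

text \<open>
  If every customer prefers \<open>i\<close> to \<open>j\<close>, then among all ways to divide a fixed number of earlier
  sales between \<open>i\<close> and \<open>j\<close>, the more lopsided one in favour of \<open>i\<close> is better. The starting loads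
  differ by an integer, which is what makes the induction work: after one more sale the order of
  the two divisions is preserved, except when the second is the mirror image of the first. In that
  case the successor states are mirror images in pairs, and the preference for \<open>i\<close> puts the larger
  weight on the better pair.
\<close>

lemma arrive_majorized_start:
  assumes I: "finite I" "i \<in> I" "j \<in> I" "i \<noteq> j"
    and ps: "\<And>p. p \<in> set ps \<Longrightarrow> subprob I p \<and> p j \<le> p i"
    and l: "l i = l j + real D" "u \<le> D"
  shows "arrive I (peak I) ps (l(i := l i - real u, j := l j + real u)) \<le> arrive I (peak I) ps l"
  using ps l
proof (induction ps arbitrary: l D u)
  case Nil
  have "(l(i := l i - real u, j := l j + real u)) k \<le> Max (l ` I)" if "k \<in> I" for k
  proof -
    have "(l(i := l i - real u, j := l j + real u)) k \<le> (if k = j then l i else l k)"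
      using Nil.prems(2,3) I(4) by auto
    also have "\<dots> \<le> Max (l ` I)" using that I by auto
    finally show ?thesis .
  qed
  then show ?case using I unfolding arrive.simps peak_def
    by (intro Max.boundedI) (auto simp del: fun_upd_apply)
next
  case (Cons p ps)
  let ?G = "arrive I (peak I) ps"
  let ?t = "\<lambda>l u. l(i := l i - real u, j := l j + real u)"
  have IH: "?G (?t l u) \<le> ?G l" if "l i = l j + real D" "u \<le> D" for l D u
    using that Cons.prems(1) by (intro Cons.IH) auto
  have sp: "subprob I p" and pij: "p j \<le> p i" using Cons.prems by auto
  have pn: "0 \<le> p k" if "k \<in> I" for k using sp that by (auto simp: subprob_def)
  define J where "J = I - {i} - {j}"
  have split: "(\<Sum>k\<in>I. p k * f k) = p i * f i + p j * f j + (\<Sum>k\<in>J. p k * f k)" for f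
    using I unfolding J_def by (subst sum.remove[of I i], simp, simp, subst sum.remove[of _ j]) auto
  have rest: "?G (bump k (?t l u)) \<le> ?G (bump k l)" if "k \<in> J" for k
  proof -
    have "bump k (?t l u) = ?t (bump k l) u" using that I by (auto simp: J_def bump_def)
    moreover have "bump k l i = bump k l j + real D" using that Cons.prems by (auto simp: J_def bump_def)
    ultimately show ?thesis using IH Cons.prems(3) by metis
  qed
  have Ii: "?G (bump i (?t l u)) \<le> ?G (bump i l)"
  proof -
    have "bump i (?t l u) = ?t (bump i l) u" using I by (auto simp: bump_def)
    moreover have "bump i l i = bump i l j + real (Suc D)" using I Cons.prems by (auto simp: bump_def)
    ultimately show ?thesis using IH Cons.prems(3) by (metis le_SucI)
  qed
  have two: "p i * ?G (bump i (?t l u)) + p j * ?G (bump j (?t l u))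
      \<le> p i * ?G (bump i l) + p j * ?G (bump j l)"
  proof (cases "u = D")
    case False
    then obtain D' where D': "D = Suc D'" "u \<le> D'" using Cons.prems(3) by (cases D) auto
    have "bump j (?t l u) = ?t (bump j l) u" using I by (auto simp: bump_def)
    moreover have "bump j l i = bump j l j + real D'" using I Cons.prems D' by (auto simp: bump_def)
    ultimately have "?G (bump j (?t l u)) \<le> ?G (bump j l)" using IH D' by metis
    then show ?thesis using Ii pn I by (intro add_mono mult_left_mono) auto
  next
    case u: True
    show ?thesis
    proof (cases D)
      case 0
      then show ?thesis using u I by simp
    next
      case (Suc E)
      \<comment> \<open>the second division is the first with \<open>i\<close> and \<open>j\<close> exchanged; a sale of \<open>j\<close> in one of them
        mirrors a sale of \<open>i\<close> in the other\<close>
      have "bump j (?t l u) = ?t (bump i l) (Suc D)"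
        using I u Cons.prems by (auto simp: bump_def fun_eq_iff)
      moreover have "bump i l i = bump i l j + real (Suc D)" using I Cons.prems by (auto simp: bump_def)
      ultimately have 1: "?G (bump j (?t l u)) \<le> ?G (bump i l)" using IH by (metis order_refl)
      have "bump i (?t l u) = ?t (bump j l) E"
        using I u Cons.prems Suc by (auto simp: bump_def fun_eq_iff)
      moreover have "bump j l i = bump j l j + real E" using I Cons.prems Suc by (auto simp: bump_def)
      ultimately have 2: "?G (bump i (?t l u)) \<le> ?G (bump j l)" using IH by (metis order_refl)
      have "p j * (?G (bump i l) - ?G (bump j (?t l u)) + (?G (bump j l) - ?G (bump i (?t l u))))
          + (p i - p j) * (?G (bump i l) - ?G (bump i (?t l u))) \<ge> 0"
        using 1 2 Ii pij pn[OF I(3)] by (intro add_nonneg_nonneg mult_nonneg_nonneg) auto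
      then show ?thesis by (simp add: algebra_simps)
    qed
  qed
  have "?G (?t l u) \<le> ?G l" using IH Cons.prems by blast
  then have "(1 - sum p I) * ?G (?t l u) \<le> (1 - sum p I) * ?G l"
    using sp by (intro mult_left_mono) (auto simp: subprob_def)
  moreover have "(\<Sum>k\<in>J. p k * ?G (bump k (?t l u))) \<le> (\<Sum>k\<in>J. p k * ?G (bump k l))"
    using rest pn by (intro sum_mono mult_left_mono) (auto simp: J_def)
  ultimately show ?case
    unfolding arrive.simps split using two by linarith
qed

text \<open>
  Let only the first customer move the mass \<open>d\<close> from \<open>j\<close> to \<open>i\<close>. The change of the expectation is
  \<open>d\<close> times the gain of starting with one sale of \<open>i\<close> instead of one sale of \<open>j\<close>.
\<close>

lemma arrive_transfer_one:
  assumes I: "finite I" "i \<in> I" "j \<in> I" "i \<noteq> j"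
    and ps: "\<And>p. p \<in> set ps \<Longrightarrow> subprob I p \<and> p j \<le> p i"
    and d: "0 \<le> d"
  shows "arrive I (peak I) (p # ps) (\<lambda>_. 0)
    \<le> arrive I (peak I) (p(i := p i + d, j := p j - d) # ps) (\<lambda>_. 0)"
proof -
  let ?G = "arrive I (peak I) ps" and ?z = "\<lambda>_. 0 :: real"
  define J where "J = I - {i} - {j}"
  have split: "(\<Sum>k\<in>I. f k) = f i + f j + (\<Sum>k\<in>J. f k)" for f :: "nat \<Rightarrow> real"
    using I unfolding J_def by (subst sum.remove[of I i], simp, simp, subst sum.remove[of _ j]) auto
  have eq: "bump j ?z = (bump i ?z)(i := bump i ?z i - real 1, j := bump i ?z j + real 1)"
    using I by (auto simp: bump_def)
  have "?G (bump j ?z) \<le> ?G (bump i ?z)"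
    unfolding eq using I ps by (intro arrive_majorized_start[where D = 1]) (auto simp: bump_def)
  then have "d * ?G (bump j ?z) \<le> d * ?G (bump i ?z)" using d by (intro mult_left_mono)
  moreover have "(\<Sum>k\<in>J. (p(i := p i + d, j := p j - d)) k * f k) = (\<Sum>k\<in>J. p k * f k)" for f
    by (intro sum.cong) (auto simp: J_def)
  moreover have "(\<Sum>k\<in>J. (p(i := p i + d, j := p j - d)) k) = (\<Sum>k\<in>J. p k)"
    by (intro sum.cong) (auto simp: J_def)
  ultimately show ?thesis
    unfolding arrive.simps split using I by (simp add: algebra_simps)
qed

text \<open>
  All customers are changed one after another. The customer being changed may be assumed to come
  first, by exchangeability, so that all loads are still zero.
\<close>

lemma arrive_transfer:
  assumes I: "finite I" "i \<in> I" "j \<in> I" "i \<noteq> j"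
    and p: "subprob I p" "p j \<le> p i" and d: "0 \<le> d" "d \<le> p j"
  shows "arrive I (peak I) (replicate T p) (\<lambda>_. 0)
    \<le> arrive I (peak I) (replicate T (p(i := p i + d, j := p j - d))) (\<lambda>_. 0)"
proof -
  let ?q = "p(i := p i + d, j := p j - d)"
  have eq: "sum ?q I = sum p I"
    using I by (simp add: sum.remove[of I i] sum.remove[of "I - {i}" j])
  have q: "subprob I ?q" "?q j \<le> ?q i" using p d I unfolding subprob_def eq by auto
  have "arrive I (peak I) (replicate T p @ ps) (\<lambda>_. 0) \<le> arrive I (peak I) (replicate T ?q @ ps) (\<lambda>_. 0)"
    if "\<And>r. r \<in> set ps \<Longrightarrow> subprob I r \<and> r j \<le> r i" for ps
    using that
  proof (induction T arbitrary: ps)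
    case (Suc T)
    have "arrive I (peak I) (p # replicate T p @ ps) (\<lambda>_. 0)
       \<le> arrive I (peak I) (?q # replicate T p @ ps) (\<lambda>_. 0)"
      using I p d Suc.prems by (intro arrive_transfer_one) auto
    also have "\<dots> = arrive I (peak I) (replicate T p @ ?q # ps) (\<lambda>_. 0)"
      by (rule arrive_middle[symmetric])
    also have "\<dots> \<le> arrive I (peak I) (replicate T ?q @ ?q # ps) (\<lambda>_. 0)"
      by (rule Suc.IH) (use Suc.prems q in auto)
    also have "\<dots> = arrive I (peak I) (replicate (Suc T) ?q @ ps) (\<lambda>_. 0)"
      by (simp only: arrive_middle replicate_Suc append_Cons)
    finally show ?case by (simp only: replicate_Suc append_Cons)
  qed simp
  from this[of "[]"] show ?thesis by simp
qed

section \<open>Majorization\<close>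

definition mean_peak :: "nat set \<Rightarrow> nat \<Rightarrow> (nat \<Rightarrow> real) \<Rightarrow> real" where
  "mean_peak I T p = arrive I (peak I) (replicate T p) (\<lambda>_. 0)"

lemma arrive_permute:
  assumes "\<sigma> permutes I"
  shows "arrive I (peak I) (map (\<lambda>p. p \<circ> \<sigma>) ps) (l \<circ> \<sigma>) = arrive I (peak I) ps l"
proof (induction ps arbitrary: l)
  case Nil
  have "(l \<circ> \<sigma>) ` I = l ` I" using permutes_image[OF assms] by (metis image_comp)
  then show ?case by (simp add: peak_def)
next
  case (Cons p ps)
  have b: "bump i (l \<circ> \<sigma>) = bump (\<sigma> i) l \<circ> \<sigma>" for i
    using permutes_inj[OF assms] by (auto simp: bump_def fun_eq_iff inj_eq)
  show ?case
    using sum.permute[OF assms, of "\<lambda>i. p i * arrive I (peak I) ps (bump i l)"]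
      sum.permute[OF assms, of p]
    unfolding list.map arrive.simps b Cons.IH by (simp add: o_def)
qed

lemma mean_peak_swap:
  assumes "i \<in> I" "j \<in> I"
  shows "mean_peak I T (x(i := x j, j := x i)) = mean_peak I T x"
proof -
  have "Transposition.transpose i j permutes I" using assms by (rule permutes_swap_id)
  from arrive_permute[OF this, of "replicate T x" "\<lambda>_. 0"]
  have "mean_peak I T (x \<circ> Transposition.transpose i j) = mean_peak I T x"
    by (simp add: mean_peak_def o_def)
  moreover have "x \<circ> Transposition.transpose i j = x(i := x j, j := x i)"
    by (auto simp: fun_eq_iff Transposition.transpose_def)
  ultimately show ?thesis by simp
qed

text \<open>
  The pair \<open>(a, b)\<close> majorizes \<open>(x i, x j)\<close>. If \<open>j\<close> is the more popular product, the names of the two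
  products are exchanged first, which does not change the expected peak.
\<close>

lemma mean_peak_transfer:
  assumes I: "finite I" "i \<in> I" "j \<in> I" "i \<noteq> j" and x: "subprob I x"
    and ab: "a + b = x i + x j" "0 \<le> b" "x i \<le> a" "x j \<le> a"
  shows "mean_peak I T x \<le> mean_peak I T (x(i := a, j := b))"
proof (cases "x j \<le> x i")
  case True
  have "x(i := a, j := b) = x(i := x i + (a - x i), j := x j - (a - x i))"
    using ab by (auto simp: fun_eq_iff)
  then show ?thesis
    using arrive_transfer[OF I x True, of "a - x i" T] ab by (simp add: mean_peak_def)
next
  case False
  let ?y = "x(i := x j, j := x i)"
  have "sum ?y I = sum x I"
    using I by (simp add: sum.remove[of I i] sum.remove[of "I - {i}" j])
  then have y: "subprob I ?y" using x I by (auto simp: subprob_def)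
  have "x(i := a, j := b) = ?y(i := ?y i + (a - x j), j := ?y j - (a - x j))"
    using ab I by (auto simp: fun_eq_iff)
  then have "mean_peak I T ?y \<le> mean_peak I T (x(i := a, j := b))"
    using arrive_transfer[OF I y, of "a - x j" T] ab False I by (simp add: mean_peak_def)
  then show ?thesis using mean_peak_swap[OF I(2,3)] by simp
qed

lemma mean_peak_mono:
  assumes I: "finite I" "I \<noteq> {}" and q: "subprob I q" and p: "\<And>i. i \<in> I \<Longrightarrow> 0 \<le> p i \<and> p i \<le> q i"
  shows "mean_peak I T p \<le> mean_peak I T q"
proof -
  have sp: "subprob I p" using p q sum_mono[of I p q] by (force simp: subprob_def)
  have "arrive I (peak I) (replicate T p) l \<le> arrive I (peak I) (replicate T q) l" for l
  proof (induction T arbitrary: l)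
    case (Suc T)
    let ?P = "arrive I (peak I) (replicate T p)" and ?Q = "arrive I (peak I) (replicate T q)"
    have "(1 - sum p I) * ?P l + (\<Sum>i\<in>I. p i * ?P (bump i l))
        \<le> (1 - sum p I) * ?Q l + (\<Sum>i\<in>I. p i * ?Q (bump i l))"
      using Suc.IH p sp by (intro add_mono mult_left_mono sum_mono) (auto simp: subprob_def)
    also have "\<dots> = ?Q l + (\<Sum>i\<in>I. p i * (?Q (bump i l) - ?Q l))"
      by (simp add: right_diff_distrib sum_subtractf sum_distrib_right left_diff_distrib)
    also have "\<dots> \<le> ?Q l + (\<Sum>i\<in>I. q i * (?Q (bump i l) - ?Q l))"
      using p q I by (intro add_left_mono sum_mono mult_right_mono)
        (auto intro!: arrive_mono simp: bump_def)
    also have "\<dots> = (1 - sum q I) * ?Q l + (\<Sum>i\<in>I. q i * ?Q (bump i l))"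
      by (simp add: right_diff_distrib sum_subtractf sum_distrib_right left_diff_distrib)
    finally show ?case by simp
  qed simp
  then show ?thesis by (simp add: mean_peak_def)
qed

lemma mean_peak_thinning:
  assumes "finite I" "I \<noteq> {}" "subprob I p" "0 \<le> c" "c \<le> 1"
  shows "c * mean_peak I T p \<le> mean_peak I T (\<lambda>i. c * p i)"
  using arrive_thinning[OF assms, of T "\<lambda>_. 0"] by (simp add: mean_peak_def)

text \<open>
  The comparison that drives the approximation. Products are divided into classes; in each class
  \<open>B\<close> takes the largest capacities \<open>w\<close> to the full, and \<open>x\<close> spreads no more mass in any way allowed by
  the capacities. Moving mass from a product outside \<open>B\<close> to an unsaturated product of \<open>B\<close> in the
  same class never hurts, and each move settles the final value of one coordinate.
\<close>

lemma mean_peak_majorized: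
  fixes cl :: "nat \<Rightarrow> 'c"
  assumes I: "finite I" "I \<noteq> {}" and B: "B \<subseteq> I" and wB: "sum w B \<le> 1"
    and w: "\<And>i. i \<in> I \<Longrightarrow> 0 \<le> w i"
    and top: "\<And>i j. i \<in> B \<Longrightarrow> j \<in> I - B \<Longrightarrow> cl i = cl j \<Longrightarrow> w j \<le> w i"
    and x: "\<And>i. i \<in> I \<Longrightarrow> 0 \<le> x i \<and> x i \<le> w i" "sum x I \<le> 1"
    and tot: "\<And>c. sum x {i\<in>I. cl i = c} \<le> sum w {i\<in>B. cl i = c}"
  shows "mean_peak I T x \<le> mean_peak I T (\<lambda>i. if i \<in> B then w i else 0)"
  using x tot
proof (induction "card {k\<in>I. x k \<noteq> (if k \<in> B then w k else 0)}" arbitrary: x rule: less_induct)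
  case less
  let ?z = "\<lambda>i. if i \<in> B then w i else 0"
  have fB: "finite B" using I B finite_subset by blast
  have "subprob I x" using less.prems by (auto simp: subprob_def)
  show ?case
  proof (cases "\<exists>j\<in>I - B. 0 < x j")
    case False
    have z: "sum ?z I = sum w B" using I B by (simp add: sum.inter_restrict[symmetric] Int_absorb1)
    have "subprob I ?z" using w wB z B by (auto simp: subprob_def)
    then show ?thesis using False less.prems(1) w by (intro mean_peak_mono I) force+
  next
    case True
    then obtain j where j: "j \<in> I" "j \<notin> B" "0 < x j" by auto
    have "\<exists>i\<in>B. cl i = cl j \<and> x i < w i"
    proof (rule ccontr)
      assume *: "\<not> ?thesis"
      have "sum w {i\<in>B. cl i = cl j} < sum w {i\<in>B. cl i = cl j} + x j" using j by simp
      also have "\<dots> \<le> sum x {i\<in>B. cl i = cl j} + x j"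
        using * by (intro add_right_mono sum_mono) force
      also have "\<dots> = sum x (insert j {i\<in>B. cl i = cl j})" using j fB by simp
      also have "\<dots> \<le> sum x {i\<in>I. cl i = cl j}"
        using I B j less.prems by (intro sum_mono2) auto
      also have "\<dots> \<le> sum w {i\<in>B. cl i = cl j}" by (rule less.prems)
      finally show False by simp
    qed
    then obtain i where i: "i \<in> B" "cl i = cl j" "x i < w i" by auto
    have ij: "i \<in> I" "i \<noteq> j" using i j B by auto
    \<comment> \<open>the largest transfer that respects the capacity of \<open>i\<close>: it fills \<open>i\<close> or empties \<open>j\<close>\<close>
    define a where "a = min (w i) (x i + x j)"
    define b where "b = x i + x j - a"
    define y where "y = x(i := a, j := b)"
    have "w j \<le> w i" using top i j by auto
    then have ab: "a + b = x i + x j" "0 \<le> b" "x i \<le> a" "x j \<le> a" "b \<le> x j" "a \<le> w i"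
      using less.prems(1)[of i] less.prems(1)[of j] ij j i by (auto simp: a_def b_def)
    have e: "y k = x k" if "k \<noteq> i" "k \<noteq> j" for k using that by (simp add: y_def)
    have "mean_peak I T x \<le> mean_peak I T y" unfolding y_def
      using I ij j ab \<open>subprob I x\<close> by (intro mean_peak_transfer) auto
    also have "\<dots> \<le> mean_peak I T ?z"
    proof (rule less.hyps)
      have "{k\<in>I. y k \<noteq> ?z k} \<subset> {k\<in>I. x k \<noteq> ?z k}"
      proof -
        define z where "z = ?z"
        have xz: "x i \<noteq> z i" "x j \<noteq> z j" using i j by (auto simp: z_def)
        have "y i = z i \<or> y j = z j"
          using ij i j by (auto simp: y_def b_def a_def z_def)
        then obtain m where "m \<in> I" "y m = z m" "x m \<noteq> z m" using xz ij j by blast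
        moreover have "x k \<noteq> z k" if "y k \<noteq> z k" for k using that xz e by metis
        ultimately have "{k\<in>I. y k \<noteq> z k} \<subset> {k\<in>I. x k \<noteq> z k}" by blast
        then show ?thesis by (simp only: z_def)
      qed
      then show "card {k\<in>I. y k \<noteq> ?z k} < card {k\<in>I. x k \<noteq> ?z k}"
        using I by (intro psubset_card_mono) auto
      show "0 \<le> y k \<and> y k \<le> w k" if "k \<in> I" for k
        using less.prems(1)[OF that] less.prems(1)[OF j(1)] less.prems(1)[OF ij(1)] ab
        by (auto simp: y_def)
      have same: "sum y A = sum x A" if A: "finite A" "i \<in> A \<longleftrightarrow> j \<in> A" for A
      proof (cases "i \<in> A")
        case True
        then show ?thesis using A ij ab
          by (simp add: sum.remove[of A i] sum.remove[of "A - {i}" j] y_def)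
      next
        case False
        then show ?thesis using A by (intro sum.cong) (auto simp: y_def)
      qed
      show "sum y I \<le> 1" using same[of I] I ij j less.prems by simp
      show "sum y {i\<in>I. cl i = c} \<le> sum w {i\<in>B. cl i = c}" for c
        using same[of "{i\<in>I. cl i = c}"] I ij i j less.prems(3)[of c] by simp
    qed
    finally show ?thesis .
  qed
qed

section \<open>The expected maximum load as an expected peak\<close>

definition purchase_prob :: "(nat \<Rightarrow> real) \<Rightarrow> nat set \<Rightarrow> nat \<Rightarrow> real" where
  "purchase_prob v S i = (if i \<in> S then v i / (1 + total_weight v S) else 0)"

lemma set_mnl_choice_subset:
  assumes "finite S" "0 \<notin> S" "\<And>i. i \<in> S \<Longrightarrow> 0 < v i"
  shows "set_pmf (mnl_choice v S) \<subseteq> insert 0 S"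
  by (auto simp: set_pmf_iff pmf_mnl_choice[OF assms] choice_prob_def split: if_splits)

lemma finite_set_customers:
  assumes "finite S" "0 \<notin> S" "\<And>i. i \<in> S \<Longrightarrow> 0 < v i"
  shows "finite (set_pmf (customers T v S))"
proof -
  have "set_pmf (customers T v S) \<subseteq> PiE_dflt {..<T} 0 (\<lambda>_. insert 0 S)"
    unfolding customers_def using set_mnl_choice_subset[of S v, OF assms]
    by (subst set_Pi_pmf) (auto simp: PiE_dflt_def)
  then show ?thesis using assms(1) by (meson finite.insertI finite_PiE_dflt finite_lessThan finite_subset)
qed

text \<open>
  Conditioning on the last customer of the joint distribution matches the recursion. The load of
  option 0 is counted by \<open>load\<close> as well, so the statistic \<open>h\<close> has to ignore coordinates outside \<open>I\<close>.
\<close>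

lemma expectation_customers:
  assumes I: "finite I" "0 \<notin> I" "S \<subseteq> I" and v: "\<And>i. i \<in> S \<Longrightarrow> 0 < v i"
    and h: "\<And>l l'. (\<And>i. i \<in> I \<Longrightarrow> l i = l' i) \<Longrightarrow> h l = h l'"
  shows "measure_pmf.expectation (customers T v S) (\<lambda>f. h (\<lambda>i. l i + real (load T f i)))
    = arrive I h (replicate T (purchase_prob v S)) l"
proof (induction T arbitrary: l)
  case 0
  then show ?case by (simp add: customers_def load_def)
next
  case (Suc T)
  let ?p = "purchase_prob v S"
  have S: "finite S" "0 \<notin> S" using I finite_subset by auto
  note pmf = pmf_mnl_choice[of S v, OF S v]
  have tw: "0 \<le> total_weight v S" unfolding total_weight_def using v
    by (intro sum_nonneg) (auto intro: less_imp_le)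
  note set = set_mnl_choice_subset[of S v, OF S v]
  note fin = finite_set_customers[of S v T, OF S v]
  have ld: "load (Suc T) (f(T := y)) i = load T f i + (if i = y then 1 else 0)" for f y i
  proof -
    have "{t. t < Suc T \<and> (f(T := y)) t = i} =
      {t. t < T \<and> f t = i} \<union> (if i = y then {T} else {})" by (auto simp: less_Suc_eq)
    then show ?thesis by (simp add: load_def)
  qed
  let ?E = "\<lambda>l. measure_pmf.expectation (customers T v S) (\<lambda>f. h (\<lambda>i. l i + real (load T f i)))"
  have "customers (Suc T) v S =
    mnl_choice v S \<bind> (\<lambda>y. map_pmf (\<lambda>f. f(T := y)) (customers T v S))"
    unfolding customers_def lessThan_Suc by (subst Pi_pmf_insert') (auto simp: map_pmf_def)
  then have "measure_pmf.expectation (customers (Suc T) v S) (\<lambda>f. h (\<lambda>i. l i + real (load (Suc T) f i)))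
    = (\<Sum>y\<in>insert 0 S. pmf (mnl_choice v S) y *\<^sub>R measure_pmf.expectation
        (map_pmf (\<lambda>f. f(T := y)) (customers T v S)) (\<lambda>f. h (\<lambda>i. l i + real (load (Suc T) f i))))"
    using set fin S by (simp only:) (subst pmf_expectation_bind[of "insert 0 S"], auto)
  also have "\<dots> = (\<Sum>y\<in>insert 0 S. choice_prob v S y * ?E (bump y l))"
  proof (rule sum.cong[OF refl])
    fix y
    have "(\<lambda>i. l i + real (load T f i + (if i = y then 1 else 0)))
       = (\<lambda>i. bump y l i + real (load T f i))" for f
      by (auto simp: bump_def fun_eq_iff)
    then show "pmf (mnl_choice v S) y *\<^sub>R measure_pmf.expectation
        (map_pmf (\<lambda>f. f(T := y)) (customers T v S)) (\<lambda>f. h (\<lambda>i. l i + real (load (Suc T) f i)))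
      = choice_prob v S y * ?E (bump y l)"
      by (simp only: pmf integral_map_pmf ld real_scaleR_def)
  qed
  also have "\<dots> = choice_prob v S 0 * ?E (bump 0 l) + (\<Sum>y\<in>S. choice_prob v S y * ?E (bump y l))"
    using S by simp
  also have "?E (bump 0 l) = ?E l"
    using I(2) by (intro Bochner_Integration.integral_cong refl h) (metis bump_def fun_upd_other)
  also have "(\<Sum>y\<in>S. choice_prob v S y * ?E (bump y l)) = (\<Sum>y\<in>I. ?p y * ?E (bump y l))"
    using I S by (intro sum.mono_neutral_cong_left) (auto simp: choice_prob_def purchase_prob_def)
  also have "choice_prob v S 0 = 1 - sum ?p I"
  proof -
    have "sum ?p I = (\<Sum>i\<in>S. v i / (1 + total_weight v S))"
      using I by (intro sum.mono_neutral_cong_right) (auto simp: purchase_prob_def)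
    also have "\<dots> = total_weight v S / (1 + total_weight v S)"
      by (simp add: total_weight_def sum_divide_distrib)
    finally show ?thesis using tw by (simp add: choice_prob_def field_simps)
  qed
  finally show ?case by (simp add: Suc.IH)
qed

lemma peak_load_eq_max_load:
  assumes I: "finite I" "0 \<notin> I" "S \<subseteq> I" "I \<noteq> {}" and v: "\<And>i. i \<in> S \<Longrightarrow> 0 < v i"
    and f: "f \<in> set_pmf (customers T v S)"
  shows "peak I (\<lambda>i. 0 + real (load T f i)) = real (max_load T S f)"
proof -
  have S: "finite S" "0 \<notin> S" using I finite_subset by auto
  note set = set_mnl_choice_subset[of S v, OF S v]
  have "f t \<in> insert 0 S" if "t < T" for t
    using f that set by (auto simp: customers_def set_Pi_pmf PiE_dflt_def)
  then have z: "load T f i = 0" if "i \<in> I - S" for i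
    using that I by (force simp: load_def)
  show ?thesis
  proof (cases "S = {}")
    case True
    then have "(\<lambda>i. real (load T f i)) ` I = {0}" using z I by force
    then show ?thesis using True by (simp add: peak_def max_load_def)
  next
    case False
    have "Max ((\<lambda>i. real (load T f i)) ` I) = Max ((\<lambda>i. real (load T f i)) ` S)"
    proof (rule antisym)
      have "real (load T f i) \<le> Max ((\<lambda>i. real (load T f i)) ` S)" if "i \<in> I" for i
      proof (cases "i \<in> S")
        case False
        obtain k where "k \<in> S" using \<open>S \<noteq> {}\<close> by auto
        have "real (load T f i) \<le> real (load T f k)" using z False that by simp
        also have "\<dots> \<le> Max ((\<lambda>i. real (load T f i)) ` S)"
          using \<open>k \<in> S\<close> \<open>finite S\<close> by (intro Max_ge) auto
        finally show ?thesis .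
      qed (use \<open>finite S\<close> in auto)
      then show "Max ((\<lambda>i. real (load T f i)) ` I) \<le> Max ((\<lambda>i. real (load T f i)) ` S)"
        using I by auto
      show "Max ((\<lambda>i. real (load T f i)) ` S) \<le> Max ((\<lambda>i. real (load T f i)) ` I)"
        using I False by (intro Max_mono) auto
    qed
    also have "\<dots> = real (Max (load T f ` S))"
      using mono_Max_commute[of real "load T f ` S"] \<open>finite S\<close> False
      by (simp add: mono_def image_image)
    finally show ?thesis using False by (simp add: peak_def max_load_def)
  qed
qed

lemma expected_max_load_eq_mean_peak:
  assumes I: "finite I" "0 \<notin> I" "S \<subseteq> I" "I \<noteq> {}" and v: "\<And>i. i \<in> S \<Longrightarrow> 0 < v i"
  shows "expected_max_load T v S = mean_peak I T (purchase_prob v S)"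
proof -
  have "expected_max_load T v S
     = measure_pmf.expectation (customers T v S) (\<lambda>f. peak I (\<lambda>i. 0 + real (load T f i)))"
    unfolding expected_max_load_def
    by (intro integral_cong_AE) (auto simp: AE_measure_pmf_iff peak_load_eq_max_load[OF I v, simplified])
  also have "\<dots> = mean_peak I T (purchase_prob v S)"
    unfolding mean_peak_def by (rule expectation_customers[OF I(1-3) v])
      (auto simp: peak_def intro: arg_cong[where f = Max])
  finally show ?thesis .
qed

section \<open>Assortments that consist of few segments\<close>

text \<open>
  The order by decreasing weight; ties are broken by the index, so that it is total.
\<close>

definition precedes :: "(nat \<Rightarrow> real) \<Rightarrow> nat \<Rightarrow> nat \<Rightarrow> bool" where
  "precedes v i j \<longleftrightarrow> v j < v i \<or> v j = v i \<and> i \<le> j"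

text \<open>
  The union of \<open>m\<close> segments of the order, coded by the \<open>2 * m\<close> endpoints \<open>x 0, x 1, \<dots>\<close>. The code
  counts products from 0, whereas products are numbered from 1.
\<close>

definition selected :: "(nat \<Rightarrow> real) \<Rightarrow> nat \<Rightarrow> nat \<Rightarrow> (nat \<Rightarrow> nat) \<Rightarrow> nat set" where
  "selected v n m x =
     {i\<in>{1..n}. \<exists>k<m. precedes v (Suc (x (2 * k))) i \<and> precedes v i (Suc (x (2 * k + 1)))}"

lemma precedes_total: "precedes v i j \<or> precedes v j i"
  and precedes_trans: "precedes v i j \<Longrightarrow> precedes v j k \<Longrightarrow> precedes v i k"
  and precedes_antisym: "precedes v i j \<Longrightarrow> precedes v j i \<Longrightarrow> i = j"
  by (auto simp: precedes_def)

lemma precedes_last: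
  assumes "finite B" "B \<noteq> {}"
  shows "\<exists>b\<in>B. \<forall>i\<in>B. precedes v i b"
  using assms
proof (induction B rule: finite_ne_induct)
  case (singleton c)
  then show ?case using precedes_total by blast
next
  case (insert c B)
  then obtain b where b: "b \<in> B" "\<forall>i\<in>B. precedes v i b" by blast
  consider "precedes v c b" | "precedes v b c" using precedes_total by blast
  then show ?case
  proof cases
    case 1
    then show ?thesis using b by (intro bexI[of _ b]) auto
  next
    case 2
    then have "precedes v i c" if "i \<in> B" for i using b(2) that precedes_trans[of v i b c] by simp
    then show ?thesis using precedes_total[of v c c] by (intro bexI[of _ c]) auto
  qed
qed

lemma precedes_first:
  assumes "finite B" "B \<noteq> {}"
  shows "\<exists>b\<in>B. \<forall>i\<in>B. precedes v b i"
  using assms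
proof (induction B rule: finite_ne_induct)
  case (singleton c)
  then show ?case using precedes_total by blast
next
  case (insert c B)
  then obtain b where b: "b \<in> B" "\<forall>i\<in>B. precedes v b i" by blast
  consider "precedes v b c" | "precedes v c b" using precedes_total by blast
  then show ?case
  proof cases
    case 1
    then show ?thesis using b by (intro bexI[of _ b]) auto
  next
    case 2
    then have "precedes v c i" if "i \<in> B" for i using b(2) that precedes_trans[of v c b i] by simp
    then show ?thesis using precedes_total[of v c c] by (intro bexI[of _ c]) auto
  qed
qed

text \<open>
  An initial segment of \<open>C\<close> in the order \<open>precedes v\<close>.
\<close>

definition top_part :: "(nat \<Rightarrow> real) \<Rightarrow> nat set \<Rightarrow> nat set \<Rightarrow> bool" where
  "top_part v C B \<longleftrightarrow> B \<subseteq> C \<and> (\<forall>i\<in>B. \<forall>j\<in>C. precedes v j i \<longrightarrow> j \<in> B)"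

lemma top_part_maximizes_sum:
  assumes C: "finite C" "top_part v C B" "A \<subseteq> C" and v: "\<And>i. i \<in> C \<Longrightarrow> 0 < v i"
    and card: "card A \<le> card B"
  shows "sum v A \<le> sum v B"
proof (cases "A - B = {}")
  case True
  have "B \<subseteq> C" "finite B" using C finite_subset by (auto simp: top_part_def)
  then show ?thesis using True v by (intro sum_mono2) (auto intro: less_imp_le)
next
  case False
  have fin: "finite A" "finite B" and BC: "B \<subseteq> C"
    using C finite_subset by (auto simp: top_part_def)
  define \<mu> where "\<mu> = Max (v ` (A - B))"
  have "\<mu> \<in> v ` (A - B)" unfolding \<mu>_def using False fin by (intro Max_in) auto
  then obtain j where j: "j \<in> A" "j \<notin> B" "v j = \<mu>" by auto
  then have "0 \<le> \<mu>" using v C by (force intro: less_imp_le)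
  have "sum v (A - B) \<le> of_nat (card (A - B)) * \<mu>"
    using fin by (intro sum_bounded_above) (auto simp: \<mu>_def)
  also have "card (A - B) \<le> card (B - A)"
    using card fin by (simp add: card_Diff_subset_Int Int_commute diff_le_mono)
  then have "of_nat (card (A - B)) * \<mu> \<le> of_nat (card (B - A)) * \<mu>"
    using \<open>0 \<le> \<mu>\<close> by (intro mult_right_mono) auto
  also have "\<dots> \<le> sum v (B - A)"
  proof (rule sum_bounded_below)
    fix i assume "i \<in> B - A"
    then have "\<not> precedes v j i" using C j by (auto simp: top_part_def)
    then show "\<mu> \<le> v i" using j by (auto simp: precedes_def)
  qed
  finally have "sum v (A - B) \<le> sum v (B - A)" .
  moreover have "sum v A = sum v (A \<inter> B) + sum v (A - B)" "sum v B = sum v (A \<inter> B) + sum v (B - A)"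
    using sum.Int_Diff[of A v B] sum.Int_Diff[of B v A] fin by (simp_all add: Int_commute)
  ultimately show ?thesis by linarith
qed

text \<open>
  The smallest initial segment of \<open>C\<close> that weighs at least as much as \<open>A\<close>. Without its last product
  \<open>b\<close> it weighs less than \<open>A\<close>. This bounds its excess weight by the weight of \<open>b\<close>; it also shows that
  the segment has at most as many elements as \<open>A\<close>, since initial segments are heaviest for their size.
\<close>

lemma top_part_cover:
  assumes C: "finite C" "A \<subseteq> C" "A \<noteq> {}" and v: "\<And>i. i \<in> C \<Longrightarrow> 0 < v i"
  obtains B b where "top_part v C B" "b \<in> B" "sum v A \<le> sum v B" "sum v (B - {b}) < sum v A"
    "card B \<le> card A"
proof -
  let ?Q = "\<lambda>B. top_part v C B \<and> sum v A \<le> sum v B"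
  have "sum v A \<le> sum v C" using C v by (intro sum_mono2) (auto intro: less_imp_le)
  then have "?Q C" by (simp add: top_part_def)
  then obtain B where B: "?Q B" and least: "\<And>B'. ?Q B' \<Longrightarrow> card B \<le> card B'"
    using ex_has_least_nat[of ?Q C card] by auto
  have fin: "finite B" using B C finite_subset by (auto simp: top_part_def)
  have "0 < sum v A" using C v finite_subset by (intro sum_pos) auto
  then have "B \<noteq> {}" using B by auto
  then obtain b where b: "b \<in> B" "\<forall>i\<in>B. precedes v i b" using precedes_last fin by blast
  have top: "top_part v C (B - {b})"
    using B b precedes_antisym unfolding top_part_def by blast
  have "card (B - {b}) < card B" using fin b by (intro card_Diff1_less)
  then have lt: "sum v (B - {b}) < sum v A" using least[of "B - {b}"] top by force
  then have "card (B - {b}) < card A"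
    using top_part_maximizes_sum[OF C(1) top C(2) v] by force
  then have "card B \<le> card A" using fin b by (simp add: card_Diff_singleton)
  then show ?thesis using that B b lt by blast
qed

lemma expected_max_load_nonneg: "0 \<le> expected_max_load T v S"
  unfolding expected_max_load_def by (intro integral_nonneg_AE) auto

lemma expected_max_load_empty: "expected_max_load T v {} = 0"
  by (simp add: expected_max_load_def max_load_def)

text \<open>
  Going from \<open>A\<close> to \<open>B\<close> has two effects. The total weight grows, which thins out the purchases by
  the quotient of the two denominators; and with a common denominator the weights of \<open>B\<close>
  majorize those of \<open>A\<close> class by class.
\<close>

lemma expected_max_load_dominated:
  fixes cl :: "nat \<Rightarrow> 'c"
  assumes I: "finite I" "0 \<notin> I" "I \<noteq> {}" and v: "\<And>i. i \<in> I \<Longrightarrow> 0 < v i"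
    and AB: "A \<subseteq> I" "B \<subseteq> I"
    and top: "\<And>c. top_part v {i\<in>I. cl i = c} {i\<in>B. cl i = c}"
    and tot: "\<And>c. sum v {i\<in>A. cl i = c} \<le> sum v {i\<in>B. cl i = c}"
    and le: "sum v A \<le> sum v B"
  shows "(1 + sum v A) / (1 + sum v B) * expected_max_load T v A \<le> expected_max_load T v B"
proof -
  define D where "D = 1 + sum v A"
  define D' where "D' = 1 + sum v B"
  have fin: "finite A" "finite B" using AB I finite_subset by auto
  have "0 \<le> sum v A" using v AB by (intro sum_nonneg) (auto intro: less_imp_le)
  then have D: "0 < D" "D \<le> D'" "0 < D'" using le by (auto simp: D_def D'_def)
  have E: "expected_max_load T v S = mean_peak I T (purchase_prob v S)" if "S \<subseteq> I" for S
    using that I v by (intro expected_max_load_eq_mean_peak) auto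
  have spA: "subprob I (purchase_prob v A)"
  proof -
    have "sum (purchase_prob v A) I = (\<Sum>i\<in>A. v i / D)"
      using I AB by (intro sum.mono_neutral_cong_right)
        (auto simp: purchase_prob_def D_def total_weight_def)
    also have "\<dots> \<le> 1" using D by (simp add: D_def flip: sum_divide_distrib)
    finally show ?thesis using D v
      by (auto simp: subprob_def purchase_prob_def total_weight_def simp flip: D_def intro!: divide_nonneg_pos less_imp_le)
  qed
  let ?x = "\<lambda>i. D / D' * purchase_prob v A i"
  have x: "?x i = (if i \<in> A then v i / D' else 0)" for i
    using D by (simp add: purchase_prob_def total_weight_def flip: D_def)
  have sx: "sum ?x J = sum v (A \<inter> J) / D'" if "finite J" for J
    unfolding x using fin that by (simp add: sum.If_cases sum_divide_distrib Int_commute)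
  have "D / D' * mean_peak I T (purchase_prob v A) \<le> mean_peak I T ?x"
    using I spA D by (intro mean_peak_thinning) auto
  also have "\<dots> \<le> mean_peak I T (\<lambda>i. if i \<in> B then v i / D' else 0)"
  proof (rule mean_peak_majorized[where cl = cl])
    show "(\<Sum>i\<in>B. v i / D') \<le> 1"
      using D by (simp add: D'_def flip: sum_divide_distrib)
    show "0 \<le> v i / D'" if "i \<in> I" for i using v[OF that] D by simp
    show "0 \<le> ?x i \<and> ?x i \<le> v i / D'" if "i \<in> I" for i
      unfolding x using v[OF that] D by simp
    show "sum ?x I \<le> 1" using sx[of I] I AB D le by (simp add: Int_absorb2 D'_def)
    fix i j assume "i \<in> B" "j \<in> I - B" "cl i = cl j"
    then have "\<not> precedes v j i" using top[of "cl i"] AB by (auto simp: top_part_def)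
    then show "v j / D' \<le> v i / D'" using D by (auto simp: precedes_def divide_right_mono)
  next
    fix c
    have "A \<inter> {i\<in>I. cl i = c} = {i\<in>A. cl i = c}" using AB by auto
    then show "sum ?x {i\<in>I. cl i = c} \<le> (\<Sum>i\<in>{i\<in>B. cl i = c}. v i / D')"
      using sx[of "{i\<in>I. cl i = c}"] I tot[of c] D
      by (simp add: divide_right_mono flip: sum_divide_distrib)
  qed (use I AB in auto)
  also have "(\<lambda>i. if i \<in> B then v i / D' else 0) = purchase_prob v B"
    by (auto simp: purchase_prob_def total_weight_def D'_def)
  finally show ?thesis using E AB by (simp add: D_def D'_def)
qed

text \<open>
  Class \<open>c\<close> with \<open>1 \<le> c \<le> m\<close> contains the weights between \<open>(1 - \<delta>) ^ c\<close> and \<open>(1 - \<delta>) ^ (c - 1)\<close> times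
  the largest weight of \<open>S\<close>, class \<open>m + 1\<close> all smaller ones and class 0 the heavier products, which
  \<open>S\<close> does not use. Every class of \<open>S\<close> is replaced by the smallest initial segment that covers
  its weight. In the classes up to \<open>m\<close> this needs no more products than before, so the weight
  grows by a factor of at most \<open>1 / (1 - \<delta>)\<close>. In the last class the excess is at most one product, hence at most
  \<open>\<delta>\<close> times the largest weight. Altogether the denominator grows by a factor of at most \<open>1 / (1 - 2 * \<delta>)\<close>.
\<close>

lemma near_optimal_class_prefixes:
  assumes I: "finite I" "0 \<notin> I" and v: "\<And>i. i \<in> I \<Longrightarrow> 0 < v i"
    and S: "S \<subseteq> I" "S \<noteq> {}" and \<delta>: "0 < \<delta>" "\<delta> < 1 / 2" "(1 - \<delta>) ^ m \<le> \<delta>"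
  obtains B and cl :: "nat \<Rightarrow> nat"
  where "B \<subseteq> I" "B \<noteq> {}" "\<And>i. i \<in> B \<Longrightarrow> cl i \<in> {1..m+1}"
    "\<And>c. top_part v {i\<in>I. cl i = c} {i\<in>B. cl i = c}"
    "\<And>i j. v i \<le> v j \<Longrightarrow> cl j \<le> cl i"
    "(1 - 2 * \<delta>) * expected_max_load T v S \<le> expected_max_load T v B"
proof -
  define w1 where "w1 = Max (v ` S)"
  define r where "r = 1 - \<delta>"
  have r: "0 < r" "r < 1" using \<delta> by (auto simp: r_def)
  have finS: "finite S" using I S finite_subset by auto
  have "w1 \<in> v ` S" unfolding w1_def using finS S by (intro Max_in) auto
  then have w1: "0 < w1" "w1 \<le> sum v S"
    using v S finS by (auto intro!: member_le_sum intro: less_imp_le)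
  have Sw1: "v i \<le> w1" if "i \<in> S" for i using that finS by (auto simp: w1_def)
  define cl where "cl i = (LEAST c. c = m + 1 \<or> w1 * r ^ c < v i)" for i
  have cl_le: "cl i \<le> m + 1" for i unfolding cl_def by (rule Least_le) simp
  have clI: "cl i = m + 1 \<or> w1 * r ^ cl i < v i" for i
    unfolding cl_def by (rule LeastI[of _ "m + 1"]) simp
  have clD: "v i \<le> w1 * r ^ c" if "c < cl i" for i c
    using not_less_Least[OF that[unfolded cl_def]] by auto
  have anti: "cl j \<le> cl i" if "v i \<le> v j" for i j
  proof (cases "cl i = m + 1")
    case True
    then show ?thesis using cl_le by simp
  next
    case False
    then have "w1 * r ^ cl i < v j" using clI[of i] that by linarith
    then show ?thesis unfolding cl_def[of j] by (intro Least_le) simp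
  qed
  have clS: "cl i \<in> {1..m+1}" if "i \<in> S" for i
  proof -
    have "cl i \<noteq> 0"
    proof
      assume "cl i = 0"
      then show False using clI[of i] Sw1[OF that] by simp
    qed
    then show ?thesis using cl_le[of i] by simp
  qed
  let ?A = "\<lambda>c. {i\<in>S. cl i = c}" and ?C = "\<lambda>c. {i\<in>I. cl i = c}"
  let ?R = "\<lambda>c B. top_part v (?C c) B \<and> sum v (?A c) \<le> sum v B \<and> (?A c = {} \<longrightarrow> B = {}) \<and>
      sum v B \<le> sum v (?A c) / r + (if c = m + 1 then \<delta> * w1 else 0)"
  have ex: "\<exists>B. ?R c B" for c
  proof (cases "?A c = {}")
    case True
    have "sum v (?A c) = 0" unfolding True by simp
    then show ?thesis using w1 \<delta> by (intro exI[of _ "{}"]) (auto simp: top_part_def)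
  next
    case False
    obtain B b where B: "top_part v (?C c) B" "b \<in> B" "sum v (?A c) \<le> sum v B"
      "sum v (B - {b}) < sum v (?A c)" "card B \<le> card (?A c)"
      using top_part_cover[of "?C c" "?A c" v] I S v False by auto
    have BC: "B \<subseteq> ?C c" using B by (simp add: top_part_def)
    have finB: "finite B" using BC I finite_subset by fastforce
    have c0: "c \<in> {1..m+1}" using False clS by auto
    have pos: "0 \<le> sum v (?A c)" using S v by (intro sum_nonneg) (auto intro: less_imp_le)
    have "sum v B \<le> sum v (?A c) / r + (if c = m + 1 then \<delta> * w1 else 0)"
    proof (cases "c = m + 1")
      case True
      have "sum v B = v b + sum v (B - {b})" using finB B by (simp add: sum.remove)
      moreover have "v b \<le> w1 * r ^ m" using BC B(2) True by (intro clD) auto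
      moreover have "w1 * r ^ m \<le> w1 * \<delta>" using w1 \<delta> by (intro mult_left_mono) (auto simp: r_def)
      moreover have "sum v (?A c) \<le> sum v (?A c) / r"
        using pos r by (simp add: le_divide_eq mult_left_le)
      ultimately show ?thesis using B True by (simp add: mult.commute)
    next
      case False
      obtain c' where c': "c = Suc c'" using c0 by (cases c) auto
      have "sum v B \<le> of_nat (card B) * (w1 * r ^ c')"
        using BC c' by (intro sum_bounded_above clD) auto
      also have "\<dots> \<le> of_nat (card (?A c)) * (w1 * r ^ c')"
        using B w1 r by (intro mult_right_mono) auto
      also have "\<dots> = of_nat (card (?A c)) * (w1 * r ^ c) / r"
        using r c' by simp
      also have "\<dots> \<le> sum v (?A c) / r"
        using clI False r by (intro divide_right_mono sum_bounded_below) (auto intro: less_imp_le)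
      finally show ?thesis using False by simp
    qed
    then show ?thesis using B False by blast
  qed
  define Bf where "Bf c = (SOME B. ?R c B)" for c
  have BfR: "?R c (Bf c)" for c unfolding Bf_def using ex[of c] by (rule someI_ex)
  have Bf: "top_part v (?C c) (Bf c)" "sum v (?A c) \<le> sum v (Bf c)"
    "?A c = {} \<Longrightarrow> Bf c = {}"
    "sum v (Bf c) \<le> sum v (?A c) / r + (if c = m + 1 then \<delta> * w1 else 0)" for c
    using BfR[of c] by simp_all
  have BfC: "Bf c \<subseteq> ?C c" for c using Bf(1)[of c] by (simp add: top_part_def)
  have BfD: "i \<in> I \<and> cl i = c" if "i \<in> Bf c" for i c using BfC[of c] that by auto
  define B where "B = (\<Union>c\<in>{1..m+1}. Bf c)"
  have clB: "cl i \<in> {1..m+1}" if "i \<in> B" for i using that by (auto simp: B_def dest: BfD)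
  have BI: "B \<subseteq> I" using BfD by (auto simp: B_def)
  have Bc: "{i\<in>B. cl i = c} = Bf c" for c
  proof (cases "c \<in> {1..m+1}")
    case True
    then show ?thesis by (auto simp: B_def dest: BfD)
  next
    case False
    then have "Bf c = {}" using clS by (intro Bf(3)) auto
    then show ?thesis using False clB by auto
  qed
  have sumS: "sum v S = (\<Sum>c\<in>{1..m+1}. sum v (?A c))"
    using finS clS by (intro sum.group[symmetric]) auto
  have finB: "finite B" using BI I finite_subset by auto
  have sumB: "sum v B = (\<Sum>c\<in>{1..m+1}. sum v (Bf c))"
    using finB clB by (subst sum.group[of B "{1..m+1}" cl v, symmetric]) (auto simp: Bc)
  have le: "sum v S \<le> sum v B" unfolding sumS sumB by (intro sum_mono Bf)
  have "sum v B \<le> (\<Sum>c\<in>{1..m+1}. sum v (?A c) / r + (if c = m + 1 then \<delta> * w1 else 0))"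
    unfolding sumB by (intro sum_mono Bf)
  also have "\<dots> = sum v S / r + \<delta> * w1"
    unfolding sumS by (simp add: sum.distrib flip: sum_divide_distrib)
  also have "\<dots> \<le> sum v S / r + \<delta> * sum v S" using w1 \<delta> by simp
  finally have ub: "sum v B \<le> sum v S / r + \<delta> * sum v S" .
  define D where "D = 1 + sum v S"
  have D: "0 < D" using w1 by (simp add: D_def)
  have "1 + sum v B \<le> D / r + \<delta> * D"
  proof -
    have "1 \<le> 1 / r" using r by simp
    moreover have "0 \<le> \<delta>" using \<delta> by simp
    ultimately show ?thesis using ub by (simp add: D_def add_divide_distrib distrib_left)
  qed
  then have "(1 - 2 * \<delta>) * (1 + sum v B) \<le> (1 - 2 * \<delta>) * (D / r + \<delta> * D)"
    using \<delta> by (intro mult_left_mono) auto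
  also have "\<dots> = ((1 - 2 * \<delta>) * (1 / r + \<delta>)) * D" by (simp add: algebra_simps)
  also have "\<dots> \<le> 1 * D"
  proof (intro mult_right_mono)
    have "1 - 2 * \<delta> \<le> (1 - \<delta>) * r" by (simp add: r_def algebra_simps)
    then have "(1 - 2 * \<delta>) / r \<le> 1 - \<delta>" using r by (simp add: divide_le_eq)
    moreover have "(1 - 2 * \<delta>) * \<delta> \<le> \<delta>" using \<delta> by (simp add: mult_right_le_one_le mult.commute)
    ultimately show "(1 - 2 * \<delta>) * (1 / r + \<delta>) \<le> 1" by (simp add: distrib_left)
  qed (use D in simp)
  finally have ratio: "1 - 2 * \<delta> \<le> (1 + sum v S) / (1 + sum v B)"
    using le w1 by (simp add: D_def le_divide_eq)
  have I0: "I \<noteq> {}" using S by auto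
  have "(1 - 2 * \<delta>) * expected_max_load T v S
      \<le> (1 + sum v S) / (1 + sum v B) * expected_max_load T v S"
    using ratio expected_max_load_nonneg by (intro mult_right_mono)
  also have "\<dots> \<le> expected_max_load T v B"
    using I I0 v S BI le Bf
    by (intro expected_max_load_dominated[where cl = cl and I = I]) (auto simp: Bc)
  finally have E: "(1 - 2 * \<delta>) * expected_max_load T v S \<le> expected_max_load T v B" .
  have "B \<noteq> {}" using le w1 by auto
  then show ?thesis using that[of B cl] BI clB Bf(1) anti E by (simp add: Bc)
qed

text \<open>
  An initial segment of a class is a segment of the whole order, because the classes themselves are
  segments.
\<close>

lemma near_optimal_interval_union:
  assumes n: "1 \<le> n" and v: "\<And>i. i \<in> {1..n} \<Longrightarrow> 0 < v i"
    and S: "S \<subseteq> {1..n}" and \<delta>: "0 < \<delta>" "\<delta> < 1 / 2" "(1 - \<delta>) ^ m \<le> \<delta>"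
  shows "\<exists>x. (\<forall>k. x k < n) \<and>
    (1 - 2 * \<delta>) * expected_max_load T v S \<le> expected_max_load T v (selected v n (m + 1) x)"
proof (cases "S = {}")
  case True
  then show ?thesis using n
    by (intro exI[of _ "\<lambda>_. 0"]) (auto simp: expected_max_load_empty expected_max_load_nonneg)
next
  case False
  obtain B and cl :: "nat \<Rightarrow> nat" where B: "B \<subseteq> {1..n}" "B \<noteq> {}" "\<And>i. i \<in> B \<Longrightarrow> cl i \<in> {1..m+1}"
    "\<And>c. top_part v {i\<in>{1..n}. cl i = c} {i\<in>B. cl i = c}"
    "\<And>i j. v i \<le> v j \<Longrightarrow> cl j \<le> cl i"
    "(1 - 2 * \<delta>) * expected_max_load T v S \<le> expected_max_load T v B"
    using near_optimal_class_prefixes[of "{1..n}" v S \<delta> m T] v S False \<delta> by auto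
  let ?B = "\<lambda>c. {i\<in>B. cl i = c}"
  have finB: "finite B" using B(1) finite_subset by auto
  let ?R = "\<lambda>c p. ?B c \<noteq> {} \<longrightarrow> fst p \<in> ?B c \<and> snd p \<in> ?B c \<and>
     (\<forall>i\<in>?B c. precedes v (fst p) i \<and> precedes v i (snd p))"
  have ex: "\<exists>p. ?R c p" for c
  proof (cases "?B c = {}")
    case False
    have "finite (?B c)" using finB by simp
    with precedes_first[OF this False, of v] precedes_last[OF this False, of v]
    obtain a b where "a \<in> ?B c" "b \<in> ?B c"
      "\<forall>i\<in>?B c. precedes v a i" "\<forall>i\<in>?B c. precedes v i b" by blast
    then show ?thesis by (intro exI[of _ "(a, b)"]) simp
  qed auto
  define p where "p c = (SOME p. ?R c p)" for c
  have "?R c (p c)" for c unfolding p_def using ex[of c] by (rule someI_ex)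
  then have p: "fst (p c) \<in> ?B c \<and> snd (p c) \<in> ?B c \<and>
     (\<forall>i\<in>?B c. precedes v (fst (p c)) i \<and> precedes v i (snd (p c)))" if "?B c \<noteq> {}" for c
    using that by blast
  have seg: "i \<in> {1..n} \<and> precedes v (fst (p c)) i \<and> precedes v i (snd (p c)) \<longleftrightarrow> i \<in> ?B c"
    if ne: "?B c \<noteq> {}" for c i
  proof
    assume i: "i \<in> {1..n} \<and> precedes v (fst (p c)) i \<and> precedes v i (snd (p c))"
    then have "v i \<le> v (fst (p c))" "v (snd (p c)) \<le> v i" by (auto simp: precedes_def)
    then have "cl (fst (p c)) \<le> cl i" "cl i \<le> cl (snd (p c))" using B(5) by auto
    then have "cl i = c" using p[OF ne] by auto
    then show "i \<in> ?B c" using B(4)[of c] p[OF ne] i unfolding top_part_def by blast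
  qed (use p[OF ne] B(1) in auto)
  obtain b0 where b0: "b0 \<in> B" using B by auto
  \<comment> \<open>an empty class repeats a nonempty one: for \<open>n = 1\<close> no pair of endpoints codes the empty segment\<close>
  define g where "g k = (if ?B (k + 1) = {} then cl b0 else k + 1)" for k
  have g: "?B (g k) \<noteq> {}" for k using b0 by (auto simp: g_def)
  define x where "x j = (if even j then fst (p (g (j div 2))) else snd (p (g (j div 2)))) - 1" for j
  have inn: "fst (p (g k)) \<in> {1..n}" "snd (p (g k)) \<in> {1..n}" for k
    using p[OF g, of k] B(1) by auto
  have "x j < n" for j using inn[of "j div 2"] by (auto simp: x_def)
  moreover have "selected v n (m + 1) x = B"
  proof -
    have x2: "Suc (x (2 * k)) = fst (p (g k))" "Suc (x (2 * k + 1)) = snd (p (g k))" for k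
      using inn[of k] by (auto simp: x_def)
    have "selected v n (m + 1) x = {i. \<exists>k<m + 1. i \<in> ?B (g k)}"
      unfolding selected_def x2 using seg[OF g] by blast
    also have "\<dots> = B"
    proof (intro equalityI subsetI)
      fix i assume i: "i \<in> B"
      define k where "k = cl i - 1"
      have "k + 1 = cl i" "k < m + 1" using B(3)[OF i] by (auto simp: k_def)
      then have "i \<in> ?B (g k)" using i by (auto simp: g_def)
      then show "i \<in> {i. \<exists>k<m + 1. i \<in> ?B (g k)}" using \<open>k < m + 1\<close> by blast
    qed auto
    finally show ?thesis .
  qed
  ultimately show ?thesis using B(6) by metis
qed

text \<open>
  The choice of \<open>m\<close> uses \<open>1 - \<delta> \<le> exp (- \<delta>)\<close> for \<open>\<delta> = \<epsilon> / 2\<close>. In the second bound the terms of order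
  \<open>1 / \<epsilon>\<close> are absorbed with \<open>1 / \<epsilon> \<le> exp 1\<close> or \<open>1 \<le> ln (1 / \<epsilon>)\<close>.
\<close>

lemma class_count_bound:
  fixes \<epsilon> :: real
  assumes "0 < \<epsilon>" "\<epsilon> < 1"
  defines "m \<equiv> nat \<lceil>2 / \<epsilon> * ln (2 / \<epsilon>)\<rceil>"
  shows "(1 - \<epsilon> / 2) ^ m \<le> \<epsilon> / 2" "real m + 1 \<le> 10 * (1 + 1 / \<epsilon> * ln (1 / \<epsilon>))"
proof -
  have m: "2 / \<epsilon> * ln (2 / \<epsilon>) \<le> real m" unfolding m_def by (rule real_nat_ceiling_ge)
  have "(1 - \<epsilon> / 2) ^ m \<le> exp (- (\<epsilon> / 2)) ^ m"
    using assms exp_ge_add_one_self[of "- (\<epsilon> / 2)"] by (intro power_mono) auto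
  also have "\<dots> = exp (- (\<epsilon> / 2 * real m))" by (simp add: mult.commute flip: exp_of_nat_mult)
  also have "\<dots> \<le> exp (- ln (2 / \<epsilon>))"
    using mult_left_mono[OF m, of "\<epsilon> / 2"] assms(1,2) by simp
  also have "\<dots> = \<epsilon> / 2" using assms by (simp add: exp_minus)
  finally show "(1 - \<epsilon> / 2) ^ m \<le> \<epsilon> / 2" .
  define X where "X = 1 / \<epsilon> * ln (1 / \<epsilon>)"
  have l: "0 \<le> ln (1 / \<epsilon>)" using assms by simp
  then have X: "0 \<le> X" using assms by (simp add: X_def)
  have inv: "1 / \<epsilon> \<le> 3 + X"
  proof (cases "1 \<le> ln (1 / \<epsilon>)")
    case True
    then have "1 / \<epsilon> * 1 \<le> 1 / \<epsilon> * ln (1 / \<epsilon>)" using assms by (intro mult_left_mono) auto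
    then show ?thesis by (simp add: X_def)
  next
    case False
    then have "exp (ln (1 / \<epsilon>)) \<le> exp 1" by simp
    then have "1 / \<epsilon> \<le> exp 1" using assms by simp
    then show ?thesis using exp_le X by linarith
  qed
  have "0 \<le> 2 / \<epsilon> * ln (2 / \<epsilon>)" using assms by simp
  then have "real m \<le> 2 / \<epsilon> * ln (2 / \<epsilon>) + 1" unfolding m_def by linarith
  also have "2 / \<epsilon> * ln (2 / \<epsilon>) = 2 * ln 2 * (1 / \<epsilon>) + 2 * X"
    using assms by (simp add: X_def ln_div field_simps)
  finally have m': "real m \<le> 2 * ln 2 * (1 / \<epsilon>) + 2 * X + 1" .
  have "2 * ln 2 * (1 / \<epsilon>) \<le> 2 * (3 + X)"
    using assms ln_2_less_1 inv by (intro mult_mono) auto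
  with m' have "real m + 1 \<le> 10 * (1 + X)" using X by simp
  then show "real m + 1 \<le> 10 * (1 + 1 / \<epsilon> * ln (1 / \<epsilon>))" by (simp only: X_def)
qed

section \<open>A formula for the expected maximum load\<close>

unbundle no vec_syntax
unbundle fps_syntax

text \<open>
  The exponential generating function of the sales of a product that already has load \<open>l\<close> and must
  not exceed load \<open>k\<close>. Keeping \<open>l\<close> as a parameter makes the derivative a function of the same kind.
\<close>

definition capped_exp :: "real \<Rightarrow> nat \<Rightarrow> nat \<Rightarrow> real fps" where
  "capped_exp w k l = Abs_fps (\<lambda>j. if l + j \<le> k then w ^ j / fact j else 0)"

lemma capped_exp_nth: "capped_exp w k l $ j = (if l + j \<le> k then w ^ j / fact j else 0)"
  by (simp add: capped_exp_def)

lemma fps_deriv_capped_exp: "fps_deriv (capped_exp w k l) = fps_const w * capped_exp w k (Suc l)"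
  by (rule fps_ext) (simp add: capped_exp_nth del: of_nat_Suc)

lemma fps_deriv_prod:
  fixes f :: "'b \<Rightarrow> 'a::comm_ring_1 fps"
  assumes "finite I"
  shows "fps_deriv (prod f I) = (\<Sum>i\<in>I. fps_deriv (f i) * prod f (I - {i}))"
  using assms
proof (induction I rule: finite_induct)
  case (insert a I)
  have "prod f (insert a I - {i}) = f a * prod f (I - {i})" if "i \<in> I" for i
  proof -
    have "insert a I - {i} = insert a (I - {i})" using that insert.hyps by auto
    then show ?thesis using insert.hyps by simp
  qed
  then have "(\<Sum>i\<in>I. fps_deriv (f i) * prod f (insert a I - {i}))
      = f a * (\<Sum>i\<in>I. fps_deriv (f i) * prod f (I - {i}))"
    by (simp add: sum_distrib_left mult.left_commute)
  moreover have "insert a I - {a} = I" using insert.hyps by auto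
  ultimately show ?case using insert by (simp add: mult.commute)
qed simp

text \<open>
  The probability that no load exceeds \<open>k\<close>. One more customer corresponds to taking the derivative
  of the generating function: by the product rule it is the sum over the possible choices of the
  customer, each of which raises one load by one.
\<close>

lemma arrive_capped:
  assumes I: "finite I"
  shows "arrive I (\<lambda>l. if \<forall>i\<in>I. l i \<le> real k then 1 else 0) (replicate s p) (\<lambda>i. real (c i))
    = fact s * (fps_exp (1 - sum p I) * (\<Prod>i\<in>I. capped_exp (p i) k (c i))) $ s"
proof (induction s arbitrary: c)
  case 0
  have "(\<Prod>i\<in>J. capped_exp (p i) k (c i)) $ 0 = (if \<forall>i\<in>J. c i \<le> k then 1 else 0)" if "finite J" for J
    using that by (induction J rule: finite_induct) (auto simp: capped_exp_nth)
  then show ?case using I by simp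
next
  case (Suc s)
  define p0 where "p0 = 1 - sum p I"
  define F where "F c = (\<Prod>i\<in>I. capped_exp (p i) k (c i))" for c
  define G where "G c = fps_exp p0 * F c" for c
  have one: "fps_deriv (capped_exp (p i) k (c i)) * (\<Prod>j\<in>I - {i}. capped_exp (p j) k (c j))
     = fps_const (p i) * F (c(i := Suc (c i)))" if "i \<in> I" for i
  proof -
    have "(\<Prod>j\<in>I - {i}. capped_exp (p j) k (c j))
       = (\<Prod>j\<in>I - {i}. capped_exp (p j) k ((c(i := Suc (c i))) j))"
      by (intro prod.cong) auto
    then show ?thesis unfolding F_def using I that
      by (simp add: prod.remove[of I i] fps_deriv_capped_exp mult.assoc)
  qed
  have "fps_deriv (F c) = (\<Sum>i\<in>I. fps_const (p i) * F (c(i := Suc (c i))))"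
    unfolding F_def[of c] fps_deriv_prod[OF I] using one by (intro sum.cong) auto
  then have "fps_deriv (G c) = fps_const p0 * G c + (\<Sum>i\<in>I. fps_const (p i) * G (c(i := Suc (c i))))"
    by (simp add: G_def sum_distrib_left mult_ac)
  then have "fps_deriv (G c) $ s
      = (fps_const p0 * G c + (\<Sum>i\<in>I. fps_const (p i) * G (c(i := Suc (c i))))) $ s" by simp
  then have "real (Suc s) * G c $ Suc s = p0 * G c $ s + (\<Sum>i\<in>I. p i * G (c(i := Suc (c i))) $ s)"
    by (simp add: fps_sum_nth del: of_nat_Suc)
  then have "fact s * (real (Suc s) * G c $ Suc s)
     = fact s * (p0 * G c $ s + (\<Sum>i\<in>I. p i * G (c(i := Suc (c i))) $ s))" by (simp only:)
  then have step: "fact (Suc s) * G c $ Suc s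
     = p0 * (fact s * G c $ s) + (\<Sum>i\<in>I. p i * (fact s * G (c(i := Suc (c i))) $ s))"
    by (simp add: sum_distrib_left distrib_left mult_ac del: of_nat_Suc)
  have b: "bump i (\<lambda>i. real (c i)) = (\<lambda>j. real ((c(i := Suc (c i))) j))" for i
    by (auto simp: bump_def)
  show ?case
    unfolding F_def[symmetric] p0_def[symmetric] G_def[symmetric] step
    unfolding replicate_Suc arrive.simps b Suc.IH
    unfolding F_def[symmetric] p0_def[symmetric] G_def[symmetric] ..
qed

text \<open>
  The expectation is the sum of the tail probabilities; at \<open>T\<close> they vanish, since there are only \<open>T\<close>
  customers.
\<close>

lemma expected_max_load_formula:
  assumes I: "finite I" "0 \<notin> I" "S \<subseteq> I" "I \<noteq> {}" and v: "\<And>i. i \<in> S \<Longrightarrow> 0 < v i"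
  shows "expected_max_load T v S = (\<Sum>k<T. 1 - fact T *
    (fps_exp (1 / (1 + total_weight v S)) * (\<Prod>i\<in>I. capped_exp (purchase_prob v S i) k 0)) $ T)"
proof -
  let ?p = "purchase_prob v S"
  let ?h = "\<lambda>k l. if \<forall>i\<in>I. l i \<le> real k then 1 else 0 :: real"
  have S: "finite S" "0 \<notin> S" using I finite_subset by auto
  note fin = finite_set_customers[of S v T, OF S v]
  have tw: "0 \<le> total_weight v S" unfolding total_weight_def using v
    by (intro sum_nonneg) (auto intro: less_imp_le)
  have "sum ?p I = (\<Sum>i\<in>S. v i / (1 + total_weight v S))"
    using I by (intro sum.mono_neutral_cong_right) (auto simp: purchase_prob_def)
  also have "\<dots> = total_weight v S / (1 + total_weight v S)"
    by (simp add: total_weight_def sum_divide_distrib)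
  finally have p0: "1 - sum ?p I = 1 / (1 + total_weight v S)"
    using tw by (simp add: field_simps)
  have tail: "real (max_load T S f) = (\<Sum>k<T. 1 - ?h k (\<lambda>i. 0 + real (load T f i)))"
    if f: "f \<in> set_pmf (customers T v S)" for f
  proof -
    have "load T f i \<le> card {..<T}" for i unfolding load_def by (intro card_mono) auto
    then have "max_load T S f \<le> T" using S by (auto simp: max_load_def)
    have h: "1 - ?h k (\<lambda>i. 0 + real (load T f i)) = (if k < max_load T S f then 1 else 0)" for k
    proof -
      have "(\<forall>i\<in>I. 0 + real (load T f i) \<le> real k) \<longleftrightarrow> peak I (\<lambda>i. 0 + real (load T f i)) \<le> real k"
        using I by (simp add: peak_def)
      also have "\<dots> \<longleftrightarrow> max_load T S f \<le> k"
        using peak_load_eq_max_load[OF I v f] by simp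
      finally show ?thesis by auto
    qed
    have "{..<T} \<inter> {k. k < max_load T S f} = {..<max_load T S f}"
      using \<open>max_load T S f \<le> T\<close> by auto
    then show ?thesis unfolding h by (simp add: sum.If_cases)
  qed
  have "expected_max_load T v S = measure_pmf.expectation (customers T v S)
      (\<lambda>f. \<Sum>k<T. 1 - ?h k (\<lambda>i. 0 + real (load T f i)))"
    unfolding expected_max_load_def by (intro integral_cong_AE) (simp_all add: AE_measure_pmf_iff tail)
  also have "\<dots> = (\<Sum>k<T. 1 - measure_pmf.expectation (customers T v S)
      (\<lambda>f. ?h k (\<lambda>i. 0 + real (load T f i))))"
    using fin by (simp add: Bochner_Integration.integral_sum Bochner_Integration.integral_diff
        integrable_measure_pmf_finite)
  also have "\<dots> = (\<Sum>k<T. 1 - arrive I (?h k) (replicate T ?p) (\<lambda>i. real ((\<lambda>_. 0) i)))"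
    by (subst expectation_customers[OF I(1-3) v]) auto
  finally show ?thesis unfolding arrive_capped[OF I(1)] p0 .
qed

section \<open>Running times of while programs\<close>

definition runs :: "com \<Rightarrow> memory \<Rightarrow> nat \<Rightarrow> (memory \<Rightarrow> bool) \<Rightarrow> bool" where
  "runs P s b R \<longleftrightarrow> (\<exists>t s'. exec P s t s' \<and> t \<le> b \<and> R s')"

fun nwrites :: "com \<Rightarrow> string set" where
  "nwrites Skip = {}"
| "nwrites (NSet a i e) = {a}"
| "nwrites (RSet a i e) = {}"
| "nwrites (Seq P Q) = nwrites P \<union> nwrites Q"
| "nwrites (Cond b P Q) = nwrites P \<union> nwrites Q"
| "nwrites (While b P) = nwrites P"

fun rwrites :: "com \<Rightarrow> string set" where
  "rwrites Skip = {}"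
| "rwrites (NSet a i e) = {}"
| "rwrites (RSet a i e) = {a}"
| "rwrites (Seq P Q) = rwrites P \<union> rwrites Q"
| "rwrites (Cond b P Q) = rwrites P \<union> rwrites Q"
| "rwrites (While b P) = rwrites P"

text \<open>
  What the program text alone says about its effect: arrays that it does not mention as targets
  keep their contents.
\<close>

definition agree :: "com \<Rightarrow> memory \<Rightarrow> memory \<Rightarrow> bool" where
  "agree P s s' \<longleftrightarrow> (\<forall>a. a \<notin> nwrites P \<longrightarrow> nmem s' a = nmem s a) \<and>
     (\<forall>a. a \<notin> rwrites P \<longrightarrow> rmem s' a = rmem s a)"

lemma mem_update [simp]:
  "nmem (nupdate a i x s) = (nmem s)(a := (nmem s a)(i := x))"
  "rmem (nupdate a i x s) = rmem s"
  "rmem (rupdate a i y s) = (rmem s)(a := (rmem s a)(i := y))"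
  "nmem (rupdate a i y s) = nmem s"
  by (simp_all add: nupdate_def rupdate_def)

lemma exec_agree: "exec P s t s' \<Longrightarrow> agree P s s'"
  by (induction rule: exec.induct) (auto simp: agree_def)

lemma runs_weaken: "runs P s b R \<Longrightarrow> b \<le> b' \<Longrightarrow> (\<And>s'. R s' \<Longrightarrow> agree P s s' \<Longrightarrow> R' s') \<Longrightarrow> runs P s b' R'"
  unfolding runs_def using exec_agree order_trans by blast

lemma runs_Seq:
  assumes "runs P s b Q" "\<And>s'. Q s' \<Longrightarrow> agree P s s' \<Longrightarrow> runs P' s' b' R"
  shows "runs (Seq P P') s (b + b') R"
  using assms unfolding runs_def by (meson add_mono exec.Seq exec_agree)

lemma runs_Cond:
  assumes "bval s c \<Longrightarrow> runs P s b R" "\<not> bval s c \<Longrightarrow> runs Q s b R"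
  shows "runs (Cond c P Q) s (1 + bcost c + b) R"
  using assms unfolding runs_def by (metis CondTrue CondFalse add_le_cancel_left)

text \<open>
  Programs without loops are executed symbolically.
\<close>

fun straight :: "com \<Rightarrow> bool" where
  "straight (Seq P Q) = (straight P \<and> straight Q)"
| "straight (Cond b P Q) = (straight P \<and> straight Q)"
| "straight (While b P) = False"
| "straight P = True"

fun outcome :: "com \<Rightarrow> memory \<Rightarrow> memory" where
  "outcome (NSet a i e) s = nupdate a (nval s i) (nval s e) s"
| "outcome (RSet a i e) s = rupdate a (nval s i) (rval s e) s"
| "outcome (Seq P Q) s = outcome Q (outcome P s)"
| "outcome (Cond b P Q) s = (if bval s b then outcome P s else outcome Q s)"
| "outcome P s = s"

fun max_cost :: "com \<Rightarrow> nat" where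
  "max_cost (NSet a i e) = 1 + ncost i + ncost e"
| "max_cost (RSet a i e) = 1 + ncost i + rcost e"
| "max_cost (Seq P Q) = max_cost P + max_cost Q"
| "max_cost (Cond b P Q) = 1 + bcost b + max (max_cost P) (max_cost Q)"
| "max_cost P = 1"

lemma exec_straight: "straight P \<Longrightarrow> \<exists>t \<le> max_cost P. exec P s t (outcome P s)"
proof (induction P arbitrary: s)
  case (Seq P Q)
  then show ?case by simp (meson add_mono exec.Seq)
next
  case (Cond b P Q)
  then obtain t u where "t \<le> max_cost P" "exec P s t (outcome P s)"
    "u \<le> max_cost Q" "exec Q s u (outcome Q s)" by fastforce
  then show ?case
    using CondTrue[of s b P t "outcome P s" Q] CondFalse[of s b Q u "outcome Q s" P]
    by (cases "bval s b") (force intro: exI[of _ "Suc (bcost b + t)"], force intro: exI[of _ "Suc (bcost b + u)"])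
next
  case Skip
  show ?case by (rule exI[of _ 1]) (simp add: exec.Skip[simplified])
next
  case (NSet a i e)
  show ?case by (rule exI[of _ "1 + ncost i + ncost e"]) (simp add: exec.NSet[simplified])
next
  case (RSet a i e)
  show ?case by (rule exI[of _ "1 + ncost i + rcost e"]) (simp add: exec.RSet[simplified])
qed simp

lemma runs_straight: "straight P \<Longrightarrow> max_cost P \<le> b \<Longrightarrow> R (outcome P s) \<Longrightarrow> runs P s b R"
  unfolding runs_def using exec_straight[of P s] order_trans by blast

text \<open>
  The counter is entry \<open>k\<close> of the array \<open>a\<close>, so that nested loops can keep their counters in one array.
\<close>

definition For :: "string \<Rightarrow> nat \<Rightarrow> nexp \<Rightarrow> com \<Rightarrow> com" where
  "For a k e P = Seq (NSet a (NConst k) (NConst 0))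
     (While (NLess (NGet a (NConst k)) e)
        (Seq P (NSet a (NConst k) (NAdd (NGet a (NConst k)) (NConst 1)))))"

lemma writes_For [simp]:
  "nwrites (For a k e P) = insert a (nwrites P)" "rwrites (For a k e P) = rwrites P"
  by (auto simp: For_def)

text \<open>
  The bound charges the initialization and the final failing test to one additional iteration.
  The body may write to the array of the loop counter, as long as it restores the counter.
\<close>

lemma runs_For_general:
  assumes e: "\<And>s'. agree (For a k e P) s s' \<Longrightarrow> nval s' e = N"
    and init: "I 0 (nupdate a k 0 s)"
    and body: "\<And>j s'. j < N \<Longrightarrow> agree (For a k e P) s s' \<Longrightarrow> nmem s' a k = j \<Longrightarrow> I j s' \<Longrightarrow>
      runs P s' b (\<lambda>s''. nmem s'' a k = j \<and> I (Suc j) (nupdate a k (Suc j) s''))"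
  shows "runs (For a k e P) s ((N + 1) * (b + ncost e + 10)) (I N)"
proof -
  let ?B = "NLess (NGet a (NConst k)) e"
  let ?Q = "Seq P (NSet a (NConst k) (NAdd (NGet a (NConst k)) (NConst 1)))"
  let ?F = "For a k e P"
  have loop: "runs (While ?B ?Q) s' (m * (b + ncost e + 10) + ncost e + 4) (I N)"
    if "j + m = N" "agree ?F s s'" "nmem s' a k = j" "I j s'" for j m s'
    using that
  proof (induction m arbitrary: j s')
    case 0
    then have "\<not> bval s' ?B" using e by simp
    then have "exec (While ?B ?Q) s' (1 + bcost ?B) s'" by (rule WhileFalse)
    moreover have "1 + bcost ?B \<le> 0 * (b + ncost e + 10) + ncost e + 4" "I N s'" using 0 by auto
    ultimately show ?case unfolding runs_def by blast
  next
    case (Suc m)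
    then have c: "bval s' ?B" using e by simp
    have "runs P s' b (\<lambda>s''. nmem s'' a k = j \<and> I (Suc j) (nupdate a k (Suc j) s''))"
      using Suc.prems by (intro body) auto
    then obtain t s'' where t: "exec P s' t s''" "t \<le> b" "nmem s'' a k = j"
      "I (Suc j) (nupdate a k (Suc j) s'')" by (auto simp: runs_def)
    let ?s = "nupdate a k (Suc j) s''"
    have Q: "exec ?Q s' (t + 6) ?s"
      using exec.Seq[OF t(1) exec.NSet[of a "NConst k" "NAdd (NGet a (NConst k)) (NConst 1)" s'']] t(3)
      by (simp add: eval_nat_numeral)
    have "agree ?F s ?s"
      using Suc.prems(2) exec_agree[OF t(1)] by (auto simp: agree_def)
    then have "runs (While ?B ?Q) ?s (m * (b + ncost e + 10) + ncost e + 4) (I N)"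
      using Suc.prems(1) t(4) by (intro Suc.IH[of "Suc j"]) auto
    then obtain u r where u: "exec (While ?B ?Q) ?s u r" "u \<le> m * (b + ncost e + 10) + ncost e + 4" "I N r"
      by (auto simp: runs_def)
    have "exec (While ?B ?Q) s' (1 + bcost ?B + (t + 6) + u) r"
      by (rule WhileTrue[OF c Q u(1)])
    moreover have "1 + bcost ?B + (t + 6) + u \<le> Suc m * (b + ncost e + 10) + ncost e + 4"
      using t(2) u(2) by simp
    ultimately show ?case using u(3) unfolding runs_def by blast
  qed
  have "agree ?F s (nupdate a k 0 s)" by (simp add: agree_def)
  then have "runs (While ?B ?Q) (nupdate a k 0 s) (N * (b + ncost e + 10) + ncost e + 4) (I N)"
    using init by (intro loop[of 0]) auto
  then obtain u r where u: "exec (While ?B ?Q) (nupdate a k 0 s) u r"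
    "u \<le> N * (b + ncost e + 10) + ncost e + 4" "I N r" by (auto simp: runs_def)
  have "exec ?F s (3 + u) r"
    unfolding For_def using exec.Seq[OF exec.NSet[of a "NConst k" "NConst 0" s], of _ u r] u(1)
    by (simp add: eval_nat_numeral)
  moreover have "3 + u \<le> (N + 1) * (b + ncost e + 10)" using u(2) by simp
  ultimately show ?thesis using u(3) unfolding runs_def by blast
qed

lemma runs_For:
  assumes a: "a \<notin> nwrites P"
    and e: "\<And>s'. agree (For a k e P) s s' \<Longrightarrow> nval s' e = N"
    and init: "I 0 (nupdate a k 0 s)"
    and body: "\<And>j s'. j < N \<Longrightarrow> agree (For a k e P) s s' \<Longrightarrow> nmem s' a k = j \<Longrightarrow> I j s' \<Longrightarrow>
      runs P s' b (\<lambda>s''. I (Suc j) (nupdate a k (Suc j) s''))"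
  shows "runs (For a k e P) s ((N + 1) * (b + ncost e + 10)) (I N)"
proof (rule runs_For_general[where I = I and N = N, OF e init])
  fix j s' assume *: "j < N" "agree (For a k e P) s s'" "nmem s' a k = j" "I j s'"
  show "runs P s' b (\<lambda>s''. nmem s'' a k = j \<and> I (Suc j) (nupdate a k (Suc j) s''))"
    by (rule runs_weaken[OF body[OF *]]) (use a * in \<open>auto simp: agree_def\<close>)
qed

section \<open>A program for the expected maximum load\<close>

text \<open>
  In the following programs the array \<open>u\<close> holds the weights of the offered assortment and \<open>D\<close> the
  denominator \<open>1 + total_weight v S\<close>. For the cap \<open>k\<close>, the array \<open>c\<close> receives the coefficients of the
  truncated exponential series of product \<open>i + 1\<close>, computed from the running term \<open>w\<close>, and \<open>A\<close> those of the
  product of the series so far; \<open>F\<close> is the factorial of \<open>T\<close> and \<open>tot\<close> sums up the tail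
  probabilities. Loop counters start from 0, which explains the successors in the indices.
\<close>

abbreviation nvar :: "string \<Rightarrow> nexp" where "nvar a \<equiv> NGet a (NConst 0)"
abbreviation rvar :: "string \<Rightarrow> rexp" where "rvar a \<equiv> RGet a (NConst 0)"
abbreviation NSuc :: "nexp \<Rightarrow> nexp" where "NSuc e \<equiv> NAdd e (NConst 1)"
abbreviation nset :: "string \<Rightarrow> nexp \<Rightarrow> com" where "nset a e \<equiv> NSet a (NConst 0) e"
abbreviation rset :: "string \<Rightarrow> rexp \<Rightarrow> com" where "rset a e \<equiv> RSet a (NConst 0) e"

definition coeffs_body :: com where
  "coeffs_body =
     Seq (Cond (NLess (nvar ''j'') (NSuc (nvar ''k'')))
            (RSet ''c'' (nvar ''j'') (rvar ''w''))
            (RSet ''c'' (nvar ''j'') (ROfNat (NConst 0))))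
         (rset ''w'' (RDiv (RDiv (RMul (rvar ''w'') (RGet ''u'' (NSuc (nvar ''i'')))) (rvar ''D''))
            (ROfNat (NSuc (nvar ''j'')))))"

definition coeffs_prog :: com where
  "coeffs_prog = Seq (rset ''w'' (ROfNat (NConst 1))) (For ''j'' 0 (NSuc (nvar ''T'')) coeffs_body)"

lemma writes_coeffs [simp]:
  "nwrites coeffs_body = {}" "rwrites coeffs_body = {''c'', ''w''}"
  "nwrites coeffs_prog = {''j''}" "rwrites coeffs_prog = {''c'', ''w''}"
  by (auto simp: coeffs_body_def coeffs_prog_def)

lemma runs_coeffs:
  "runs coeffs_prog s ((nmem s ''T'' 0 + 2) * 60) (\<lambda>s'. \<forall>j\<le>nmem s ''T'' 0. rmem s' ''c'' j =
     capped_exp (rmem s ''u'' (Suc (nmem s ''i'' 0)) / rmem s ''D'' 0) (nmem s ''k'' 0) 0 $ j)"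
proof -
  define T where "T = nmem s ''T'' 0"
  define k where "k = nmem s ''k'' 0"
  define p where "p = rmem s ''u'' (Suc (nmem s ''i'' 0)) / rmem s ''D'' 0"
  let ?I = "\<lambda>J s'. rmem s' ''w'' 0 = p ^ J / fact J \<and> (\<forall>j<J. rmem s' ''c'' j = capped_exp p k 0 $ j)"
  have loop: "runs (For ''j'' 0 (NSuc (nvar ''T'')) coeffs_body) s1
      ((Suc T + 1) * (40 + ncost (NSuc (nvar ''T'')) + 10)) (?I (Suc T))"
    if s1: "rmem s1 ''w'' 0 = 1" "agree (rset ''w'' (ROfNat (NConst 1))) s s1" for s1
  proof (rule runs_For[where I = ?I])
    show "nval s' (NSuc (nvar ''T'')) = Suc T"
      if "agree (For ''j'' 0 (NSuc (nvar ''T'')) coeffs_body) s1 s'" for s'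
      using that s1 by (simp add: agree_def T_def)
    show "?I 0 (nupdate ''j'' 0 0 s1)" using s1 by simp
    fix J s' assume J: "agree (For ''j'' 0 (NSuc (nvar ''T'')) coeffs_body) s1 s'"
      "nmem s' ''j'' 0 = J" "?I J s'"
    have v: "nmem s' ''k'' 0 = k" "rmem s' ''u'' (Suc (nmem s' ''i'' 0)) / rmem s' ''D'' 0 = p"
      using J(1) s1 by (simp_all add: agree_def k_def p_def)
    show "runs coeffs_body s' 40 (\<lambda>s''. ?I (Suc J) (nupdate ''j'' 0 (Suc J) s''))"
      by (rule runs_straight)
        (use J(2,3) v in \<open>auto simp: coeffs_body_def capped_exp_nth less_Suc_eq mult_ac\<close>)
  qed simp
  have "runs coeffs_prog s (4 + (Suc T + 1) * (40 + ncost (NSuc (nvar ''T'')) + 10)) (?I (Suc T))"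
    unfolding coeffs_prog_def
    by (rule runs_Seq[where Q = "\<lambda>s'. rmem s' ''w'' 0 = 1", OF runs_straight loop]) simp_all
  then show ?thesis
    by (rule runs_weaken) (simp_all add: T_def k_def p_def less_Suc_eq_le)
qed

text \<open>
  The product of the power series in \<open>A\<close> and \<open>c\<close>, up to degree \<open>T\<close>. The coefficients are replaced in
  place, from degree \<open>T\<close> downwards, because the coefficient of degree \<open>s\<close> needs the old ones up to \<open>s\<close>.
\<close>

definition convolve_prog :: com where
  "convolve_prog = For ''r'' 0 (NSuc (nvar ''T''))
     (Seq (Seq (nset ''s'' (NSub (nvar ''T'') (nvar ''r''))) (rset ''acc'' (ROfNat (NConst 0))))
       (Seq (For ''j'' 0 (NSuc (nvar ''s''))
          (rset ''acc'' (RAdd (rvar ''acc'')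
            (RMul (RGet ''A'' (nvar ''j'')) (RGet ''c'' (NSub (nvar ''s'') (nvar ''j'')))))))
       (RSet ''A'' (nvar ''s'') (rvar ''acc''))))"

lemma writes_convolve [simp]:
  "nwrites convolve_prog = {''r'', ''s'', ''j''}" "rwrites convolve_prog = {''acc'', ''A''}"
  by (auto simp: convolve_prog_def)

lemma runs_convolve:
  assumes A: "\<And>j. j \<le> nmem s ''T'' 0 \<Longrightarrow> rmem s ''A'' j = f $ j"
    and c: "\<And>j. j \<le> nmem s ''T'' 0 \<Longrightarrow> rmem s ''c'' j = g $ j"
  shows "runs convolve_prog s ((nmem s ''T'' 0 + 2)\<^sup>2 * 60)
    (\<lambda>s'. \<forall>j\<le>nmem s ''T'' 0. rmem s' ''A'' j = (f * g) $ j)"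
proof -
  define T where "T = nmem s ''T'' 0"
  let ?acc = "rset ''acc'' (RAdd (rvar ''acc'')
            (RMul (RGet ''A'' (nvar ''j'')) (RGet ''c'' (NSub (nvar ''s'') (nvar ''j'')))))"
  let ?init = "Seq (nset ''s'' (NSub (nvar ''T'') (nvar ''r''))) (rset ''acc'' (ROfNat (NConst 0)))"
  let ?inner = "For ''j'' 0 (NSuc (nvar ''s'')) ?acc"
  let ?body = "Seq ?init (Seq ?inner (RSet ''A'' (nvar ''s'') (rvar ''acc'')))"
  let ?I = "\<lambda>R s'. \<forall>j\<le>T. rmem s' ''A'' j = (if T < j + R then (f * g) $ j else f $ j)"
  have inner: "runs ?inner s1 ((Suc q + 1) * (20 + ncost (NSuc (nvar ''s'')) + 10))
      (\<lambda>s'. rmem s' ''acc'' 0 = (f * g) $ q)"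
    if s1: "rmem s1 ''acc'' 0 = 0" "nmem s1 ''s'' 0 = q"
      "\<And>j. j \<le> q \<Longrightarrow> rmem s1 ''A'' j = f $ j" "\<And>j. j \<le> q \<Longrightarrow> rmem s1 ''c'' j = g $ j" for s1 q
  proof (rule runs_weaken[OF runs_For[where I = "\<lambda>J s'. rmem s' ''acc'' 0 = (\<Sum>j<J. f $ j * g $ (q - j))"
        and N = "Suc q" and b = 20]])
    show "nval s' (NSuc (nvar ''s'')) = Suc q" if "agree ?inner s1 s'" for s'
      using that s1 by (simp add: agree_def)
    show "rmem (nupdate ''j'' 0 0 s1) ''acc'' 0 = (\<Sum>j<0. f $ j * g $ (q - j))" using s1 by simp
    fix J s' assume J: "J < Suc q" "agree ?inner s1 s'" "nmem s' ''j'' 0 = J"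
      "rmem s' ''acc'' 0 = (\<Sum>j<J. f $ j * g $ (q - j))"
    have v: "nmem s' ''s'' 0 = q" "rmem s' ''A'' J = f $ J" "rmem s' ''c'' (q - J) = g $ (q - J)"
      using J s1 by (simp_all add: agree_def)
    show "runs ?acc s' 20
       (\<lambda>s''. rmem (nupdate ''j'' 0 (Suc J) s'') ''acc'' 0 = (\<Sum>j<Suc J. f $ j * g $ (q - j)))"
      by (rule runs_straight) (use J v in simp_all)
  next
    fix s' assume "rmem s' ''acc'' 0 = (\<Sum>j<Suc q. f $ j * g $ (q - j))"
    then show "rmem s' ''acc'' 0 = (f * g) $ q"
      by (simp add: fps_mult_nth atLeast0AtMost lessThan_Suc_atMost)
  qed simp_all
  have body: "runs ?body s1 ((T + 2) * 50) (\<lambda>s'. ?I (Suc R) (nupdate ''r'' 0 (Suc R) s'))"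
    if R: "R < Suc T" "agree convolve_prog s s1" "nmem s1 ''r'' 0 = R" "?I R s1" for R s1
  proof -
    define q where "q = T - R"
    have T1: "nmem s1 ''T'' 0 = T" and c1: "\<And>j. j \<le> T \<Longrightarrow> rmem s1 ''c'' j = g $ j"
      using R c by (simp_all add: agree_def T_def)
    have "runs ?body s1 (11 + ((Suc q + 1) * (20 + ncost (NSuc (nvar ''s'')) + 10) + 5))
      (\<lambda>s'. ?I (Suc R) (nupdate ''r'' 0 (Suc R) s'))"
    proof (rule runs_Seq[where Q = "\<lambda>s'. rmem s' ''acc'' 0 = 0 \<and> nmem s' ''s'' 0 = q"])
      show "runs ?init s1 11 (\<lambda>s'. rmem s' ''acc'' 0 = 0 \<and> nmem s' ''s'' 0 = q)"
        by (rule runs_straight) (use R T1 in \<open>simp_all add: q_def\<close>)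
      fix s2 assume s2: "rmem s2 ''acc'' 0 = 0 \<and> nmem s2 ''s'' 0 = q" "agree ?init s1 s2"
      have A2: "rmem s2 ''A'' = rmem s1 ''A''" "rmem s2 ''c'' = rmem s1 ''c''"
        using s2 by (simp_all add: agree_def)
      show "runs (Seq ?inner (RSet ''A'' (nvar ''s'') (rvar ''acc''))) s2
        ((Suc q + 1) * (20 + ncost (NSuc (nvar ''s'')) + 10) + 5)
        (\<lambda>s'. ?I (Suc R) (nupdate ''r'' 0 (Suc R) s'))"
      proof (rule runs_Seq[OF inner])
        fix s3 assume s3: "rmem s3 ''acc'' 0 = (f * g) $ q" "agree ?inner s2 s3"
        have v: "nmem s3 ''s'' 0 = q" "rmem s3 ''A'' = rmem s1 ''A''"
          using s2 s3 by (simp_all add: agree_def)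
        show "runs (RSet ''A'' (nvar ''s'') (rvar ''acc'')) s3 5
          (\<lambda>s'. ?I (Suc R) (nupdate ''r'' 0 (Suc R) s'))"
          by (rule runs_straight) (use v s3 R in \<open>auto simp: q_def\<close>)
      qed (use s2 A2 R c1 in \<open>auto simp: q_def\<close>)
    qed
    then show ?thesis by (rule runs_weaken) (auto simp: q_def)
  qed
  have "runs convolve_prog s ((Suc T + 1) * ((T + 2) * 50 + ncost (NSuc (nvar ''T'')) + 10)) (?I (Suc T))"
    unfolding convolve_prog_def
  proof (rule runs_For[where I = ?I])
    show "nval s' (NSuc (nvar ''T'')) = Suc T" if "agree (For ''r'' 0 (NSuc (nvar ''T'')) ?body) s s'" for s'
      using that by (simp add: agree_def T_def)
    show "?I 0 (nupdate ''r'' 0 0 s)" using A by (simp add: T_def)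
  qed (use body in \<open>simp_all add: convolve_prog_def\<close>)
  then show ?thesis
    by (rule runs_weaken) (auto simp: T_def power2_eq_square algebra_simps)
qed

definition tail_init :: com where
  "tail_init = Seq (Seq (rset ''A'' (ROfNat (NConst 1))) (rset ''F'' (ROfNat (NConst 1))))
     (For ''j'' 0 (nvar ''T'') (Seq
       (RSet ''A'' (NSuc (nvar ''j'')) (RDiv (RDiv (RGet ''A'' (nvar ''j'')) (rvar ''D'')) (ROfNat (NSuc (nvar ''j'')))))
       (rset ''F'' (RMul (rvar ''F'') (ROfNat (NSuc (nvar ''j'')))))))"

definition tail_prog :: com where
  "tail_prog = Seq tail_init (Seq (For ''i'' 0 (nvar ''n'') (Seq coeffs_prog convolve_prog))
     (rset ''tot'' (RAdd (rvar ''tot'') (RSub (ROfNat (NConst 1)) (RMul (rvar ''F'') (RGet ''A'' (nvar ''T'')))))))"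

lemma writes_tail [simp]:
  "nwrites tail_init = {''j''}" "rwrites tail_init = {''A'', ''F''}"
  "nwrites tail_prog = {''i'', ''j'', ''r'', ''s''}"
  "rwrites tail_prog = {''A'', ''F'', ''c'', ''w'', ''acc'', ''tot''}"
  by (auto simp: tail_init_def tail_prog_def)

lemma runs_tail_init:
  "runs tail_init s ((nmem s ''T'' 0 + 2) * 50) (\<lambda>s'. rmem s' ''F'' 0 = fact (nmem s ''T'' 0) \<and>
     (\<forall>j\<le>nmem s ''T'' 0. rmem s' ''A'' j = fps_exp (1 / rmem s ''D'' 0) $ j))"
proof -
  define T where "T = nmem s ''T'' 0"
  define d where "d = rmem s ''D'' 0"
  let ?init = "Seq (rset ''A'' (ROfNat (NConst 1))) (rset ''F'' (ROfNat (NConst 1)))"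
  let ?body = "Seq
       (RSet ''A'' (NSuc (nvar ''j'')) (RDiv (RDiv (RGet ''A'' (nvar ''j'')) (rvar ''D'')) (ROfNat (NSuc (nvar ''j'')))))
       (rset ''F'' (RMul (rvar ''F'') (ROfNat (NSuc (nvar ''j'')))))"
  let ?I = "\<lambda>J s'. rmem s' ''F'' 0 = fact J \<and> (\<forall>j\<le>J. rmem s' ''A'' j = fps_exp (1 / d) $ j)"
  have loop: "runs (For ''j'' 0 (nvar ''T'') ?body) s1 ((T + 1) * (30 + ncost (nvar ''T'') + 10)) (?I T)"
    if s1: "?I 0 s1" "agree ?init s s1" for s1
  proof (rule runs_For[where I = ?I])
    show "nval s' (nvar ''T'') = T" if "agree (For ''j'' 0 (nvar ''T'') ?body) s1 s'" for s'
      using that s1 by (simp add: agree_def T_def)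
    show "?I 0 (nupdate ''j'' 0 0 s1)" using s1 by simp
    fix J s' assume J: "agree (For ''j'' 0 (nvar ''T'') ?body) s1 s'" "nmem s' ''j'' 0 = J" "?I J s'"
    have v: "rmem s' ''D'' 0 = d" using J(1) s1 by (simp add: agree_def d_def)
    show "runs ?body s' 30 (\<lambda>s''. ?I (Suc J) (nupdate ''j'' 0 (Suc J) s''))"
      by (rule runs_straight)
        (use J(2,3) v in \<open>auto simp: le_Suc_eq mult_ac power_divide\<close>)
  qed simp
  have "runs tail_init s (8 + (T + 1) * (30 + ncost (nvar ''T'') + 10)) (?I T)"
    unfolding tail_init_def
    by (rule runs_Seq[where Q = "?I 0", OF runs_straight loop]) simp_all
  then show ?thesis
    by (rule runs_weaken) (auto simp: T_def d_def)
qed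

definition tail_value :: "nat \<Rightarrow> nat \<Rightarrow> (nat \<Rightarrow> real) \<Rightarrow> real \<Rightarrow> nat \<Rightarrow> real" where
  "tail_value T n u d k = 1 - fact T *
    (fps_exp (1 / d) * (\<Prod>i\<in>{1..n}. capped_exp (u i / d) k 0)) $ T"

lemma runs_tail:
  "runs tail_prog s ((nmem s ''n'' 0 + 1) * (nmem s ''T'' 0 + 2)\<^sup>2 * 130)
    (\<lambda>s'. rmem s' ''tot'' 0 = rmem s ''tot'' 0 +
      tail_value (nmem s ''T'' 0) (nmem s ''n'' 0) (rmem s ''u'') (rmem s ''D'' 0) (nmem s ''k'' 0))"
proof -
  define T where "T = nmem s ''T'' 0"
  define n where "n = nmem s ''n'' 0"
  define k where "k = nmem s ''k'' 0"
  define d where "d = rmem s ''D'' 0"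
  define u where "u = rmem s ''u''"
  define c where "c i = capped_exp (u i / d) k 0" for i
  let ?f = "\<lambda>J. fps_exp (1 / d) * (\<Prod>i\<in>{1..J}. c i)"
  let ?I = "\<lambda>J s'. \<forall>j\<le>T. rmem s' ''A'' j = ?f J $ j"
  let ?body = "Seq coeffs_prog convolve_prog"
  let ?loop = "For ''i'' 0 (nvar ''n'') ?body"
  have loop: "runs ?loop s1 ((n + 1) * ((T + 2) * 60 + (T + 2)\<^sup>2 * 60 + ncost (nvar ''n'') + 10)) (?I n)"
    if s1: "?I 0 s1" "agree tail_init s s1" for s1
  proof (rule runs_For[where I = ?I])
    show "nval s' (nvar ''n'') = n" if "agree ?loop s1 s'" for s'
      using that s1 by (simp add: agree_def n_def)
    show "?I 0 (nupdate ''i'' 0 0 s1)" using s1 by simp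
    fix J s' assume J: "agree ?loop s1 s'" "nmem s' ''i'' 0 = J" "?I J s'"
    have v: "nmem s' ''T'' 0 = T" "nmem s' ''k'' 0 = k" "rmem s' ''u'' = u" "rmem s' ''D'' 0 = d"
      using J(1) s1 by (simp_all add: agree_def T_def k_def u_def d_def)
    show "runs ?body s' ((T + 2) * 60 + (T + 2)\<^sup>2 * 60) (\<lambda>s''. ?I (Suc J) (nupdate ''i'' 0 (Suc J) s''))"
    proof (rule runs_Seq[OF runs_coeffs[of s', unfolded v J(2), folded c_def]])
      fix s2 assume s2: "\<forall>j\<le>T. rmem s2 ''c'' j = c (Suc J) $ j" "agree coeffs_prog s' s2"
      have v2: "nmem s2 ''T'' 0 = T" "rmem s2 ''A'' = rmem s' ''A''"
        using s2 v by (simp_all add: agree_def)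
      have "runs convolve_prog s2 ((nmem s2 ''T'' 0 + 2)\<^sup>2 * 60)
          (\<lambda>s'. \<forall>j\<le>nmem s2 ''T'' 0. rmem s' ''A'' j = (?f J * c (Suc J)) $ j)"
        by (rule runs_convolve) (use s2 v2 J(3) in simp_all)
      then show "runs convolve_prog s2 ((T + 2)\<^sup>2 * 60) (\<lambda>s''. ?I (Suc J) (nupdate ''i'' 0 (Suc J) s''))"
        by (rule runs_weaken) (use v2 in \<open>simp_all add: atLeastAtMostSuc_conv mult_ac\<close>)
    qed
  qed simp
  let ?add = "rset ''tot'' (RAdd (rvar ''tot'') (RSub (ROfNat (NConst 1)) (RMul (rvar ''F'') (RGet ''A'' (nvar ''T'')))))"
  have "runs tail_prog s ((T + 2) * 50 + ((n + 1) * ((T + 2) * 60 + (T + 2)\<^sup>2 * 60 + ncost (nvar ''n'') + 10) + 20))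
    (\<lambda>s'. rmem s' ''tot'' 0 = rmem s ''tot'' 0 + tail_value T n u d k)"
    unfolding tail_prog_def
  proof (rule runs_Seq[OF runs_tail_init[of s, folded T_def d_def]])
    fix s1 assume s1: "rmem s1 ''F'' 0 = fact T \<and> (\<forall>j\<le>T. rmem s1 ''A'' j = fps_exp (1 / d) $ j)"
      "agree tail_init s s1"
    show "runs (Seq ?loop ?add) s1 ((n + 1) * ((T + 2) * 60 + (T + 2)\<^sup>2 * 60 + ncost (nvar ''n'') + 10) + 20)
       (\<lambda>s'. rmem s' ''tot'' 0 = rmem s ''tot'' 0 + tail_value T n u d k)"
    proof (rule runs_Seq[OF loop])
      show "?I 0 s1" using s1 by simp
      show "agree tail_init s s1" by fact
      fix s2 assume s2: "?I n s2" "agree ?loop s1 s2"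
      have v: "nmem s2 ''T'' 0 = T" "rmem s2 ''F'' 0 = fact T" "rmem s2 ''tot'' 0 = rmem s ''tot'' 0"
        using s1 s2 by (simp_all add: agree_def T_def)
      show "runs ?add s2 20 (\<lambda>s'. rmem s' ''tot'' 0 = rmem s ''tot'' 0 + tail_value T n u d k)"
        by (rule runs_straight) (use v s2(1) in \<open>simp_all add: tail_value_def c_def\<close>)
    qed
  qed
  then show ?thesis
  proof (rule runs_weaken)
    have "(T + 2) * 2 \<le> (T + 2)\<^sup>2" by (simp add: power2_eq_square)
    then have "(n + 1) * ((T + 2) * 2) \<le> (n + 1) * (T + 2)\<^sup>2" by (rule mult_left_mono) simp
    then have "(T + 2) * 50 + ((n + 1) * ((T + 2) * 60 + (T + 2)\<^sup>2 * 60 + ncost (nvar ''n'') + 10) + 20)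
      \<le> (n + 1) * (T + 2)\<^sup>2 * 130" by (simp add: algebra_simps)
    then show "(T + 2) * 50 + ((n + 1) * ((T + 2) * 60 + (T + 2)\<^sup>2 * 60 + ncost (nvar ''n'') + 10) + 20)
      \<le> (nmem s ''n'' 0 + 1) * (nmem s ''T'' 0 + 2)\<^sup>2 * 130" by (simp add: T_def n_def)
  qed (simp add: T_def n_def u_def d_def k_def)
qed

definition value_prog :: com where
  "value_prog = Seq (rset ''tot'' (ROfNat (NConst 0))) (For ''k'' 0 (nvar ''T'') tail_prog)"

lemma writes_value [simp]:
  "nwrites value_prog = {''k'', ''i'', ''j'', ''r'', ''s''}"
  "rwrites value_prog = {''A'', ''F'', ''c'', ''w'', ''acc'', ''tot''}"
  by (auto simp: value_prog_def)

lemma runs_value: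
  "runs value_prog s ((nmem s ''n'' 0 + 1) * (nmem s ''T'' 0 + 2) ^ 3 * 140)
    (\<lambda>s'. rmem s' ''tot'' 0 =
      (\<Sum>k<nmem s ''T'' 0. tail_value (nmem s ''T'' 0) (nmem s ''n'' 0) (rmem s ''u'') (rmem s ''D'' 0) k))"
proof -
  define T where "T = nmem s ''T'' 0"
  define n where "n = nmem s ''n'' 0"
  define g where "g = tail_value T n (rmem s ''u'') (rmem s ''D'' 0)"
  define b where "b = (n + 1) * (T + 2)\<^sup>2 * 130"
  let ?I = "\<lambda>J s'. rmem s' ''tot'' 0 = (\<Sum>k<J. g k)"
  let ?loop = "For ''k'' 0 (nvar ''T'') tail_prog"
  have loop: "runs ?loop s1 ((T + 1) * (b + ncost (nvar ''T'') + 10)) (?I T)"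
    if s1: "?I 0 s1" "agree (rset ''tot'' (ROfNat (NConst 0))) s s1" for s1
  proof (rule runs_For[where I = ?I])
    show "nval s' (nvar ''T'') = T" if "agree ?loop s1 s'" for s'
      using that s1 by (simp add: agree_def T_def)
    show "?I 0 (nupdate ''k'' 0 0 s1)" using s1 by simp
    fix J s' assume J: "agree ?loop s1 s'" "nmem s' ''k'' 0 = J" "?I J s'"
    have v: "nmem s' ''T'' 0 = T" "nmem s' ''n'' 0 = n" "rmem s' ''u'' = rmem s ''u''"
      "rmem s' ''D'' = rmem s ''D''"
      using J(1) s1 by (simp_all add: agree_def T_def n_def)
    show "runs tail_prog s' b (\<lambda>s''. ?I (Suc J) (nupdate ''k'' 0 (Suc J) s''))"
      by (rule runs_weaken[OF runs_tail]) (use J v in \<open>simp_all add: b_def g_def\<close>)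
  qed simp
  have "runs value_prog s (4 + (T + 1) * (b + ncost (nvar ''T'') + 10)) (?I T)"
    unfolding value_prog_def
    by (rule runs_Seq[where Q = "?I 0", OF runs_straight loop]) simp_all
  then show ?thesis
  proof (rule runs_weaken)
    define y where "y = (n + 1) * (T + 2)\<^sup>2"
    have "4 \<le> (T + 2)\<^sup>2" by (simp add: power2_eq_square)
    then have "4 \<le> y" unfolding y_def by (metis le_add2 mult_le_mono nat_mult_1)
    have b_y: "b = y * 130" by (simp add: b_def y_def)
    have "4 + (T + 1) * (b + ncost (nvar ''T'') + 10) \<le> (T + 2) * (b + 12)" by (simp add: algebra_simps)
    also have "\<dots> \<le> (T + 2) * (y * 140)"
      using \<open>4 \<le> y\<close> by (intro mult_left_mono) (simp_all add: b_y)
    also have "\<dots> = (n + 1) * (T + 2) ^ 3 * 140" by (simp only: y_def power2_eq_square power3_eq_cube mult_ac)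
    finally show "4 + (T + 1) * (b + ncost (nvar ''T'') + 10)
      \<le> (nmem s ''n'' 0 + 1) * (nmem s ''T'' 0 + 2) ^ 3 * 140" by (simp add: T_def n_def)
  qed (simp add: T_def n_def g_def)
qed

section \<open>Exhaustive search over the segment endpoints\<close>

definition precedes_test :: "nexp \<Rightarrow> nexp \<Rightarrow> bexp" where
  "precedes_test a b = BAnd (BNot (RLess (RGet ''v'' a) (RGet ''v'' b)))
     (BNot (BAnd (BNot (RLess (RGet ''v'' b) (RGet ''v'' a))) (NLess b a)))"

primrec selected_test :: "nat \<Rightarrow> bexp" where
  "selected_test 0 = NLess (NConst 0) (NConst 0)"
| "selected_test (Suc m) = BNot (BAnd (BNot (selected_test m)) (BNot (BAnd
     (precedes_test (NSuc (NGet ''x'' (NConst (2 * m)))) (NSuc (nvar ''i'')))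
     (precedes_test (NSuc (nvar ''i'')) (NSuc (NGet ''x'' (NConst (2 * m + 1))))))))"

lemma bval_precedes_test:
  "bval s (precedes_test a b) \<longleftrightarrow> precedes (rmem s ''v'') (nval s a) (nval s b)"
  by (auto simp: precedes_test_def precedes_def)

lemma bval_selected_test:
  "bval s (selected_test m) \<longleftrightarrow> (\<exists>k<m. precedes (rmem s ''v'') (Suc (nmem s ''x'' (2 * k))) (Suc (nmem s ''i'' 0)) \<and>
     precedes (rmem s ''v'') (Suc (nmem s ''i'' 0)) (Suc (nmem s ''x'' (2 * k + 1))))"
  by (induction m) (auto simp: bval_precedes_test less_Suc_eq)

lemma bcost_selected_test: "bcost (selected_test m) \<le> 3 + 100 * m"
  by (induction m) (auto simp: precedes_test_def)

definition offer_body :: "nat \<Rightarrow> com" where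
  "offer_body m = Seq (Cond (selected_test m)
         (RSet ''u'' (NSuc (nvar ''i'')) (RGet ''v'' (NSuc (nvar ''i''))))
         (RSet ''u'' (NSuc (nvar ''i'')) (ROfNat (NConst 0))))
       (rset ''D'' (RAdd (rvar ''D'') (RGet ''u'' (NSuc (nvar ''i'')))))"

text \<open>
  Products outside the assortment get weight 0 in \<open>u\<close>; their capped exponential is then 1, so the
  program that evaluates the formula may run over all products.
\<close>

definition offer_prog :: "nat \<Rightarrow> com" where
  "offer_prog m = Seq (rset ''D'' (ROfNat (NConst 1))) (For ''i'' 0 (nvar ''n'') (offer_body m))"

lemma writes_offer [simp]:
  "nwrites (offer_body m) = {}" "rwrites (offer_body m) = {''u'', ''D''}"
  "nwrites (offer_prog m) = {''i''}" "rwrites (offer_prog m) = {''u'', ''D''}"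
  by (auto simp: offer_body_def offer_prog_def)

lemma runs_offer:
  fixes s :: memory and m :: nat
  defines "v \<equiv> rmem s ''v''" and "n \<equiv> nmem s ''n'' 0"
  defines "S \<equiv> selected v n m (nmem s ''x'')"
  shows "runs (offer_prog m) s ((n + 1) * (100 * m + 60))
    (\<lambda>s'. (\<forall>i\<in>{1..n}. rmem s' ''u'' i = (if i \<in> S then v i else 0)) \<and>
       rmem s' ''D'' 0 = 1 + total_weight v S)"
proof -
  let ?w = "\<lambda>i. if i \<in> S then v i else 0"
  let ?I = "\<lambda>J s'. (\<forall>i\<in>{1..J}. rmem s' ''u'' i = ?w i) \<and> rmem s' ''D'' 0 = 1 + (\<Sum>i\<in>{1..J}. ?w i)"
  let ?loop = "For ''i'' 0 (nvar ''n'') (offer_body m)"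
  have loop: "runs ?loop s1 ((n + 1) * (100 * m + 40 + ncost (nvar ''n'') + 10)) (?I n)"
    if s1: "?I 0 s1" "agree (rset ''D'' (ROfNat (NConst 1))) s s1" for s1
  proof (rule runs_For[where I = ?I])
    show "nval s' (nvar ''n'') = n" if "agree ?loop s1 s'" for s'
      using that s1 by (simp add: agree_def n_def)
    show "?I 0 (nupdate ''i'' 0 0 s1)" using s1 by simp
    fix J s' assume J: "J < n" "agree ?loop s1 s'" "nmem s' ''i'' 0 = J" "?I J s'"
    have v: "rmem s' ''v'' = v" "nmem s' ''x'' = nmem s ''x''"
      using J(2) s1 by (simp_all add: agree_def v_def)
    have sel: "bval s' (selected_test m) \<longleftrightarrow> Suc J \<in> S"
      unfolding bval_selected_test v J(3) S_def selected_def using J(1) by auto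
    have "max_cost (offer_body m) \<le> 100 * m + 40"
      using bcost_selected_test[of m] by (simp add: offer_body_def)
    then show "runs (offer_body m) s' (100 * m + 40) (\<lambda>s''. ?I (Suc J) (nupdate ''i'' 0 (Suc J) s''))"
      by (rule runs_straight[rotated])
        (use J(3,4) v sel in \<open>auto simp: offer_body_def atLeastAtMostSuc_conv\<close>)
  qed simp
  have "runs (offer_prog m) s (4 + (n + 1) * (100 * m + 40 + ncost (nvar ''n'') + 10)) (?I n)"
    unfolding offer_prog_def
    by (rule runs_Seq[where Q = "?I 0", OF runs_straight loop]) simp_all
  then show ?thesis
  proof (rule runs_weaken)
    have "(\<Sum>i\<in>{1..n}. ?w i) = total_weight v S"
    proof -
      have "{1..n} \<inter> S = S" by (auto simp: S_def selected_def)
      then show ?thesis unfolding total_weight_def by (simp add: sum.If_cases)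
    qed
    then show "(\<forall>i\<in>{1..n}. rmem s' ''u'' i = ?w i) \<and> rmem s' ''D'' 0 = 1 + total_weight v S"
      if "?I n s'" for s' using that by simp
  qed (simp add: algebra_simps)
qed

definition keep_body :: com where
  "keep_body = Cond (RLess (ROfNat (NConst 0)) (RGet ''u'' (NSuc (nvar ''i''))))
     (NSet ''S'' (NSuc (nvar ''i'')) (NConst 1)) (NSet ''S'' (NSuc (nvar ''i'')) (NConst 0))"

definition keep_prog :: com where
  "keep_prog = Cond (RLess (rvar ''best'') (rvar ''tot''))
     (Seq (rset ''best'' (rvar ''tot'')) (For ''i'' 0 (nvar ''n'') keep_body)) Skip"

lemma writes_keep [simp]:
  "nwrites keep_body = {''S''}" "rwrites keep_body = {}"
  "nwrites keep_prog = {''i'', ''S''}" "rwrites keep_prog = {''best''}"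
  by (auto simp: keep_body_def keep_prog_def)

lemma runs_keep:
  fixes s :: memory
  defines "n \<equiv> nmem s ''n'' 0"
  shows "runs keep_prog s ((n + 1) * 60)
    (\<lambda>s'. if rmem s ''best'' 0 < rmem s ''tot'' 0
      then rmem s' ''best'' 0 = rmem s ''tot'' 0 \<and>
        output_assortment n s' = {i\<in>{1..n}. 0 < rmem s ''u'' i}
      else s' = s)"
proof -
  let ?R = "\<lambda>s'. if rmem s ''best'' 0 < rmem s ''tot'' 0
      then rmem s' ''best'' 0 = rmem s ''tot'' 0 \<and>
        output_assortment n s' = {i\<in>{1..n}. 0 < rmem s ''u'' i}
      else s' = s"
  let ?copy = "rset ''best'' (rvar ''tot'')" and ?loop = "For ''i'' 0 (nvar ''n'') keep_body"
  let ?I = "\<lambda>J s'. \<forall>i\<in>{1..J}. (nmem s' ''S'' i \<noteq> 0) = (0 < rmem s ''u'' i)"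
  have loop: "runs ?loop s1 ((n + 1) * (25 + ncost (nvar ''n'') + 10)) (?I n)"
    if s1: "agree ?copy s s1" for s1
  proof (rule runs_For[where I = ?I])
    show "nval s' (nvar ''n'') = n" if "agree ?loop s1 s'" for s'
      using that s1 by (simp add: agree_def n_def)
    show "?I 0 (nupdate ''i'' 0 0 s1)" by simp
    fix J s' assume J: "agree ?loop s1 s'" "nmem s' ''i'' 0 = J" "?I J s'"
    have v: "rmem s' ''u'' = rmem s ''u''" using J(1) s1 by (simp add: agree_def)
    show "runs keep_body s' 25 (\<lambda>s''. ?I (Suc J) (nupdate ''i'' 0 (Suc J) s''))"
      by (rule runs_straight) (use J(2,3) v in \<open>auto simp: keep_body_def atLeastAtMostSuc_conv\<close>)
  qed simp
  have "runs keep_prog s (1 + bcost (RLess (rvar ''best'') (rvar ''tot'')) +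
      (4 + (n + 1) * (25 + ncost (nvar ''n'') + 10))) ?R"
    unfolding keep_prog_def
  proof (rule runs_Cond)
    assume better: "bval s (RLess (rvar ''best'') (rvar ''tot''))"
    show "runs (Seq ?copy ?loop) s (4 + (n + 1) * (25 + ncost (nvar ''n'') + 10)) ?R"
    proof (rule runs_Seq)
      show "runs ?copy s 4 (\<lambda>s'. rmem s' ''best'' 0 = rmem s ''tot'' 0)"
        by (rule runs_straight) simp_all
      fix s1 assume s1: "rmem s1 ''best'' 0 = rmem s ''tot'' 0" "agree ?copy s s1"
      show "runs ?loop s1 ((n + 1) * (25 + ncost (nvar ''n'') + 10)) ?R"
      proof (rule runs_weaken[OF loop[OF s1(2)] order_refl])
        fix s' assume s': "?I n s'" "agree ?loop s1 s'"
        have "rmem s' ''best'' 0 = rmem s ''tot'' 0" using s' s1(1) by (simp add: agree_def)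
        moreover have "output_assortment n s' = {i\<in>{1..n}. 0 < rmem s ''u'' i}"
          unfolding output_assortment_def using s'(1) by blast
        ultimately show "?R s'" using better by simp
      qed
    qed
  next
    assume "\<not> bval s (RLess (rvar ''best'') (rvar ''tot''))"
    then show "runs Skip s (4 + (n + 1) * (25 + ncost (nvar ''n'') + 10)) ?R"
      by (intro runs_straight) simp_all
  qed
  then show ?thesis by (rule runs_weaken) simp_all
qed

definition try_prog :: "nat \<Rightarrow> com" where
  "try_prog m = Seq (offer_prog m) (Seq value_prog keep_prog)"

lemma writes_try [simp]:
  "nwrites (try_prog m) = {''i'', ''j'', ''k'', ''r'', ''s'', ''S''}"
  "rwrites (try_prog m) = {''A'', ''D'', ''F'', ''c'', ''u'', ''w'', ''acc'', ''best'', ''tot''}"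
  by (auto simp: try_prog_def)

text \<open>
  The factor \<open>T + 2\<close> stands for the iteration bound of a loop over the degrees \<open>0, \<dots>, T\<close>, including the
  additional iteration that \<open>runs_For\<close> charges.
\<close>

definition try_cost :: "nat \<Rightarrow> nat \<Rightarrow> nat \<Rightarrow> nat" where
  "try_cost m T n = (n + 1) * (T + 2) ^ 3 * (300 * (m + 1))"

lemma runs_try:
  fixes s :: memory and m :: nat
  defines "v \<equiv> rmem s ''v''" and "T \<equiv> nmem s ''T'' 0" and "n \<equiv> nmem s ''n'' 0"
  defines "S \<equiv> selected v n m (nmem s ''x'')"
  assumes n: "1 \<le> n" and v: "\<And>i. i \<in> {1..n} \<Longrightarrow> 0 < v i"
    and best: "rmem s ''best'' 0 = expected_max_load T v (output_assortment n s)"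
  shows "runs (try_prog m) s (try_cost m T n)
    (\<lambda>s'. rmem s' ''best'' 0 = expected_max_load T v (output_assortment n s') \<and>
      rmem s' ''best'' 0 = max (rmem s ''best'' 0) (expected_max_load T v S))"
proof -
  let ?R = "\<lambda>s'. rmem s' ''best'' 0 = expected_max_load T v (output_assortment n s') \<and>
      rmem s' ''best'' 0 = max (rmem s ''best'' 0) (expected_max_load T v S)"
  have S: "S \<subseteq> {1..n}" by (auto simp: S_def selected_def)
  have "runs (try_prog m) s ((n + 1) * (100 * m + 60) +
      ((n + 1) * (T + 2) ^ 3 * 140 + (n + 1) * 60)) ?R"
    unfolding try_prog_def
  proof (rule runs_Seq[OF runs_offer[of m s, folded v_def n_def, folded S_def]])
    fix s1 assume s1: "(\<forall>i\<in>{1..n}. rmem s1 ''u'' i = (if i \<in> S then v i else 0)) \<and>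
      rmem s1 ''D'' 0 = 1 + total_weight v S" "agree (offer_prog m) s s1"
    have v1: "nmem s1 ''T'' 0 = T" "nmem s1 ''n'' 0 = n"
      using s1 by (simp_all add: agree_def T_def n_def)
    have "tail_value T n (rmem s1 ''u'') (rmem s1 ''D'' 0) k = 1 - fact T *
      (fps_exp (1 / (1 + total_weight v S)) * (\<Prod>i\<in>{1..n}. capped_exp (purchase_prob v S i) k 0)) $ T" for k
    proof -
      have "(\<Prod>i\<in>{1..n}. capped_exp (rmem s1 ''u'' i / rmem s1 ''D'' 0) k 0)
        = (\<Prod>i\<in>{1..n}. capped_exp (purchase_prob v S i) k 0)"
        using s1 by (intro prod.cong) (auto simp: purchase_prob_def)
      then show ?thesis using s1 by (simp add: tail_value_def)
    qed
    then have val: "(\<Sum>k<T. tail_value T n (rmem s1 ''u'') (rmem s1 ''D'' 0) k) = expected_max_load T v S"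
      using S n v by (subst expected_max_load_formula[of "{1..n}"]) auto
    show "runs (Seq value_prog keep_prog) s1 ((n + 1) * (T + 2) ^ 3 * 140 + (n + 1) * 60) ?R"
    proof (rule runs_Seq[OF runs_value[of s1, unfolded v1 val]])
      fix s2 assume s2: "rmem s2 ''tot'' 0 = expected_max_load T v S" "agree value_prog s1 s2"
      have v2: "nmem s2 ''n'' 0 = n" "rmem s2 ''best'' 0 = rmem s ''best'' 0"
        "rmem s2 ''u'' = rmem s1 ''u''" "nmem s2 ''S'' = nmem s ''S''"
        using s1 s2 by (simp_all add: agree_def n_def)
      have out: "output_assortment n s2 = output_assortment n s" 
        using v2 by (simp add: output_assortment_def)
      \<comment> \<open>weights of products are positive, so the support of \<open>u\<close> is the offered assortment\<close>
      have pos: "{i\<in>{1..n}. 0 < rmem s2 ''u'' i} = S"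
        using s1 v2 S v by (force split: if_splits)
      show "runs keep_prog s2 ((n + 1) * 60) ?R"
        by (rule runs_weaken[OF runs_keep[of s2, unfolded v2(1) pos]])
          (use s2 v2 out best in \<open>auto simp: max_def split: if_splits\<close>)
    qed
  qed
  then show ?thesis
  proof (rule runs_weaken)
    have "1 \<le> (T + 2) ^ 3" by simp
    then have "(n + 1) * (100 * m + 120) * 1 \<le> (n + 1) * (100 * m + 120) * (T + 2) ^ 3"
      by (intro mult_left_mono) auto
    then show "(n + 1) * (100 * m + 60) + ((n + 1) * (T + 2) ^ 3 * 140 + (n + 1) * 60) \<le> try_cost m T n"
      by (simp add: try_cost_def algebra_simps)
  qed
qed

text \<open>
  The number of nested loops is fixed by the program text. This is how the accuracy, which
  determines the number of segments, enters the program.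
\<close>

primrec nest :: "nat \<Rightarrow> com \<Rightarrow> com" where
  "nest 0 P = P"
| "nest (Suc k) P = For ''x'' k (nvar ''n'') (nest k P)"

lemma writes_nest: "nwrites (nest k P) \<subseteq> insert ''x'' (nwrites P)" "rwrites (nest k P) = rwrites P"
  by (induction k) auto

definition best_so_far :: "nat \<Rightarrow> nat \<Rightarrow> (nat \<Rightarrow> real) \<Rightarrow> memory \<Rightarrow> bool" where
  "best_so_far T n v s \<longleftrightarrow> nmem s ''T'' 0 = T \<and> nmem s ''n'' 0 = n \<and> rmem s ''v'' = v \<and>
     rmem s ''best'' 0 = expected_max_load T v (output_assortment n s)"

text \<open>
  Every loop contributes a factor \<open>n + 4\<close>: the rule for loops charges \<open>n + 1\<close> executions of the body,
  and the loop control takes \<open>12 * (n + 1)\<close> steps, at most three times as many as the body.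
\<close>

lemma runs_nest:
  assumes n: "1 \<le> n" and v: "\<And>i. i \<in> {1..n} \<Longrightarrow> 0 < v i"
    and s: "best_so_far T n v s"
  shows "runs (nest k (try_prog m)) s ((n + 4) ^ k * try_cost m T n)
    (\<lambda>s'. best_so_far T n v s' \<and> rmem s ''best'' 0 \<le> rmem s' ''best'' 0 \<and>
      (\<forall>i\<ge>k. nmem s' ''x'' i = nmem s ''x'' i) \<and>
      (\<forall>x. (\<forall>i<k. x i < n) \<and> (\<forall>i\<ge>k. x i = nmem s ''x'' i) \<longrightarrow>
         expected_max_load T v (selected v n m x) \<le> rmem s' ''best'' 0))"
  using s
proof (induction k arbitrary: s)
  case 0
  have b: "nmem s ''T'' 0 = T" "nmem s ''n'' 0 = n" "rmem s ''v'' = v"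
     "rmem s ''best'' 0 = expected_max_load T v (output_assortment n s)"
    using 0 by (simp_all add: best_so_far_def)
  have "runs (try_prog m) s (try_cost m T n)
    (\<lambda>s'. rmem s' ''best'' 0 = expected_max_load T v (output_assortment n s') \<and>
      rmem s' ''best'' 0 = max (rmem s ''best'' 0) (expected_max_load T v (selected v n m (nmem s ''x''))))"
    using runs_try[of s m, unfolded b(1-3)] n v b(4) by simp
  then show ?case unfolding nest.simps
  proof (rule runs_weaken)
    fix s' assume s': "rmem s' ''best'' 0 = expected_max_load T v (output_assortment n s') \<and>
      rmem s' ''best'' 0 = max (rmem s ''best'' 0) (expected_max_load T v (selected v n m (nmem s ''x'')))"
      "agree (try_prog m) s s'"
    have "best_so_far T n v s'" "nmem s' ''x'' = nmem s ''x''"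
      using s' b by (simp_all add: best_so_far_def agree_def)
    moreover have "expected_max_load T v (selected v n m x) \<le> rmem s' ''best'' 0"
      if "\<forall>i. x i = nmem s ''x'' i" for x
    proof -
      have "x = nmem s ''x''" using that by auto
      then show ?thesis using conjunct2[OF s'(1)] by simp
    qed
    moreover have "rmem s ''best'' 0 \<le> rmem s' ''best'' 0" using conjunct2[OF s'(1)] by simp
    ultimately show "best_so_far T n v s' \<and> rmem s ''best'' 0 \<le> rmem s' ''best'' 0 \<and>
      (\<forall>i\<ge>0. nmem s' ''x'' i = nmem s ''x'' i) \<and>
      (\<forall>x. (\<forall>i<0. x i < n) \<and> (\<forall>i\<ge>0. x i = nmem s ''x'' i) \<longrightarrow>
         expected_max_load T v (selected v n m x) \<le> rmem s' ''best'' 0)"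
      by simp
  qed simp
next
  case (Suc k)
  let ?P = "nest k (try_prog m)"
  let ?E = "\<lambda>x. expected_max_load T v (selected v n m x)"
  let ?I = "\<lambda>J s'. best_so_far T n v s' \<and> rmem s ''best'' 0 \<le> rmem s' ''best'' 0 \<and>
      (\<forall>i\<ge>Suc k. nmem s' ''x'' i = nmem s ''x'' i) \<and>
      (\<forall>x. (\<forall>i<k. x i < n) \<and> x k < J \<and> (\<forall>i\<ge>Suc k. x i = nmem s ''x'' i) \<longrightarrow> ?E x \<le> rmem s' ''best'' 0)"
  define b where "b = (n + 4) ^ k * try_cost m T n"
  have "runs (For ''x'' k (nvar ''n'') ?P) s ((n + 1) * (b + ncost (nvar ''n'') + 10)) (?I n)"
  proof (rule runs_For_general[where I = ?I])
    show "nval s' (nvar ''n'') = n" if "agree (For ''x'' k (nvar ''n'') ?P) s s'" for s'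
    proof -
      have "''n'' \<notin> nwrites (For ''x'' k (nvar ''n'') ?P)" using writes_nest(1)[of k "try_prog m"] by auto
      then show ?thesis using that Suc.prems by (simp add: agree_def best_so_far_def)
    qed
    show "?I 0 (nupdate ''x'' k 0 s)"
      using Suc.prems by (auto simp: best_so_far_def output_assortment_def)
    fix J s' assume J: "J < n" "nmem s' ''x'' k = J" "?I J s'"
    show "runs ?P s' b (\<lambda>s''. nmem s'' ''x'' k = J \<and> ?I (Suc J) (nupdate ''x'' k (Suc J) s''))"
      unfolding b_def
    proof (rule runs_weaken[OF Suc.IH])
      show "best_so_far T n v s'" using J by simp
      fix s'' assume IH: "best_so_far T n v s'' \<and> rmem s' ''best'' 0 \<le> rmem s'' ''best'' 0 \<and>
        (\<forall>i\<ge>k. nmem s'' ''x'' i = nmem s' ''x'' i) \<and>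
        (\<forall>x. (\<forall>i<k. x i < n) \<and> (\<forall>i\<ge>k. x i = nmem s' ''x'' i) \<longrightarrow> ?E x \<le> rmem s'' ''best'' 0)"
      have "?E x \<le> rmem s'' ''best'' 0"
        if x: "\<forall>i<k. x i < n" "x k < Suc J" "\<forall>i\<ge>Suc k. x i = nmem s ''x'' i" for x
      proof (cases "x k = J")
        case True
        then have "\<forall>i\<ge>k. x i = nmem s' ''x'' i"
          using x(3) J(2,3) by (metis le_neq_implies_less Suc_leI)
        then show ?thesis using IH x by blast
      next
        case False
        then have "?E x \<le> rmem s' ''best'' 0" using x J(3) by simp
        then show ?thesis using IH by linarith
      qed
      moreover have "best_so_far T n v (nupdate ''x'' k (Suc J) s'')"
        using IH by (simp add: best_so_far_def output_assortment_def)
      ultimately show "nmem s'' ''x'' k = J \<and> ?I (Suc J) (nupdate ''x'' k (Suc J) s'')"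
        using IH J by auto
    qed simp
  qed
  then show ?case unfolding nest.simps
  proof (rule runs_weaken)
    have "1 * ((n + 1) * (4 * 1)) \<le> (n + 4) ^ k * ((n + 1) * ((T + 2) ^ 3 * (300 * (m + 1))))"
    proof (intro mult_le_mono)
      have "(2 :: nat) ^ 3 \<le> (T + 2) ^ 3" by (rule power_mono) auto
      then show "4 \<le> (T + 2) ^ 3" by simp
    qed auto
    then have "4 * (n + 1) \<le> b"
      by (simp only: b_def try_cost_def mult.assoc mult_1 mult_1_right mult.commute[of 4])
    then have "(n + 1) * (b + ncost (nvar ''n'') + 10) \<le> (n + 4) * b" by (simp add: algebra_simps)
    then show "(n + 1) * (b + ncost (nvar ''n'') + 10) \<le> (n + 4) ^ Suc k * try_cost m T n"
      by (simp add: b_def mult.assoc)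
  qed (auto simp: less_Suc_eq)
qed

lemma runs_nest_zero:
  assumes n: "1 \<le> n" and v: "\<And>i. i \<in> {1..n} \<Longrightarrow> 0 < v i"
    and s: "best_so_far T n v s" "nmem s ''x'' = (\<lambda>_. 0)"
  shows "runs (nest (2 * m) (try_prog m)) s ((n + 4) ^ (2 * m) * try_cost m T n)
    (\<lambda>s'. \<forall>x. (\<forall>i. x i < n) \<longrightarrow> expected_max_load T v (selected v n m x)
       \<le> expected_max_load T v (output_assortment n s'))"
proof (rule runs_weaken[OF runs_nest[where T = T and n = n and v = v] order_refl], fact n)
  show "0 < v i" if "i \<in> {1..n}" for i by (rule v[OF that])
  show "best_so_far T n v s" by (rule s)
  fix s'
  assume s': "best_so_far T n v s' \<and> rmem s ''best'' 0 \<le> rmem s' ''best'' 0 \<and>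
      (\<forall>i\<ge>2 * m. nmem s' ''x'' i = nmem s ''x'' i) \<and>
      (\<forall>x. (\<forall>i<2 * m. x i < n) \<and> (\<forall>i\<ge>2 * m. x i = nmem s ''x'' i) \<longrightarrow>
         expected_max_load T v (selected v n m x) \<le> rmem s' ''best'' 0)"
  show "\<forall>x. (\<forall>i. x i < n) \<longrightarrow> expected_max_load T v (selected v n m x)
      \<le> expected_max_load T v (output_assortment n s')"
  proof (intro allI impI)
    fix x :: "nat \<Rightarrow> nat"
    assume x: "\<forall>i. x i < n"
    define y where "y i = (if i < 2 * m then x i else 0)" for i
    have "selected v n m x = selected v n m y"
    proof -
      have "y (2 * k) = x (2 * k)" "y (Suc (2 * k)) = x (Suc (2 * k))" if "k < m" for k
        using that by (simp_all add: y_def)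
      then show ?thesis by (auto simp: selected_def)
    qed
    moreover have "(\<forall>i<2 * m. y i < n) \<and> (\<forall>i\<ge>2 * m. y i = nmem s ''x'' i)"
      using x s(2) by (simp add: y_def)
    ultimately have "expected_max_load T v (selected v n m x) \<le> rmem s' ''best'' 0"
      using s' by metis
    then show "expected_max_load T v (selected v n m x) \<le> expected_max_load T v (output_assortment n s')"
      using s' by (simp add: best_so_far_def)
  qed
qed

text \<open>
  The program sees only the weights of \<open>1, \<dots>, n\<close>; the input memory sets all others to 0.
\<close>

lemma expected_max_load_cong:
  assumes "\<And>i. i \<in> S \<Longrightarrow> v i = w i"
  shows "expected_max_load T v S = expected_max_load T w S"
proof -
  have "total_weight v S = total_weight w S"
    unfolding total_weight_def using assms by (intro sum.cong) auto
  then have "choice_prob v S = choice_prob w S"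
    using assms by (auto simp: choice_prob_def fun_eq_iff)
  then show ?thesis by (simp add: expected_max_load_def customers_def mnl_choice_def)
qed

text \<open>
  A single product is treated separately: the nested loops would take a number of steps that
  depends on the accuracy, whereas the time bound for \<open>n = 1\<close> does not.
\<close>

definition search_prog :: "nat \<Rightarrow> com" where
  "search_prog m = Cond (NLess (nvar ''n'') (NConst 2)) (NSet ''S'' (NConst 1) (NConst 1))
     (nest (2 * m) (try_prog m))"

text \<open>
  From two products on, all factors that depend on \<open>m\<close> can be absorbed into a power of \<open>n\<close>:
  \<open>n + 4 \<le> n ^ 3\<close> and \<open>m + 1 \<le> n ^ m\<close>.
\<close>

lemma search_cost_bound:
  assumes n: "2 \<le> n" and T: "1 \<le> T" and m: "1 \<le> m"
  shows "5 + (n + 4) ^ (2 * m) * try_cost m T n \<le> 8105 * T ^ 3 * n ^ (9 * m)"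
proof -
  have two: "n * 2 \<le> n * n" using n by simp
  have "n + 4 \<le> n ^ 3"
  proof -
    have "(2 * 2) * n \<le> (n * n) * n" using n by (intro mult_le_mono) auto
    then have "4 * n \<le> n ^ 3" by (simp add: power3_eq_cube)
    then show ?thesis using n by linarith
  qed
  then have "(n + 4) ^ (2 * m) \<le> (n ^ 3) ^ (2 * m)" by (rule power_mono) simp
  then have 1: "(n + 4) ^ (2 * m) \<le> n ^ (6 * m)" by (simp flip: power_mult)
  have 2: "n + 1 \<le> n ^ 2" unfolding power2_eq_square using two n by linarith
  have "m + 1 \<le> 2 ^ m" using less_exp[of m] by linarith
  also have "\<dots> \<le> n ^ m" using n by (rule power_mono) simp
  finally have 3: "300 * (m + 1) \<le> 300 * n ^ m" by simp
  have "(T + 2) ^ 3 \<le> (3 * T) ^ 3" using T by (intro power_mono) auto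
  then have 4: "(T + 2) ^ 3 \<le> 27 * T ^ 3" by (simp add: power_mult_distrib)
  have "(n + 4) ^ (2 * m) * try_cost m T n \<le> n ^ (6 * m) * (n ^ 2 * (27 * T ^ 3) * (300 * n ^ m))"
    unfolding try_cost_def by (intro mult_le_mono 1 2 3 4)
  also have "\<dots> = (27 * 300) * T ^ 3 * n ^ (6 * m + 2 + m)" by (simp only: power_add mult_ac)
  finally have 5: "(n + 4) ^ (2 * m) * try_cost m T n \<le> 8100 * T ^ 3 * n ^ (6 * m + 2 + m)" by simp
  have "n ^ (6 * m + 2 + m) \<le> n ^ (9 * m)" using n m by (intro power_increasing) auto
  then have "8100 * T ^ 3 * n ^ (6 * m + 2 + m) \<le> 8100 * T ^ 3 * n ^ (9 * m)" by (rule mult_left_mono) simp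
  with 5 have "(n + 4) ^ (2 * m) * try_cost m T n \<le> 8100 * T ^ 3 * n ^ (9 * m)" by (rule order_trans)
  moreover have "1 \<le> T ^ 3 * n ^ (9 * m)" using n T by (simp add: Suc_le_eq)
  ultimately show ?thesis unfolding mult.assoc by linarith
qed

lemma runs_search:
  fixes \<delta> :: real
  assumes T: "1 \<le> T" and n: "1 \<le> n" and v: "\<And>i. i \<in> {1..n} \<Longrightarrow> 0 < v i"
    and \<delta>: "0 < \<delta>" "\<delta> < 1 / 2" "(1 - \<delta>) ^ m \<le> \<delta>"
  shows "runs (search_prog (m + 1)) (input_memory T n v) (8105 * T ^ 3 * n ^ (9 * (m + 1)))
    (\<lambda>s. \<forall>S\<subseteq>{1..n}. (1 - 2 * \<delta>) * expected_max_load T v S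
       \<le> expected_max_load T v (output_assortment n s))"
proof -
  let ?s = "input_memory T n v"
  let ?R = "\<lambda>s. \<forall>S\<subseteq>{1..n}. (1 - 2 * \<delta>) * expected_max_load T v S
       \<le> expected_max_load T v (output_assortment n s)"
  have mem: "nmem ?s ''T'' 0 = T" "nmem ?s ''n'' 0 = n" "nmem ?s ''S'' = (\<lambda>_. 0)"
    "nmem ?s ''x'' = (\<lambda>_. 0)" "rmem ?s ''best'' 0 = 0"
    "rmem ?s ''v'' = (\<lambda>i. if i \<in> {1..n} then v i else 0)"
    by (simp_all add: input_memory_def)
  show ?thesis
  proof (cases "n = 1")
    case True
    have "runs (search_prog (m + 1)) ?s (1 + bcost (NLess (nvar ''n'') (NConst 2)) + 3) ?R"
      unfolding search_prog_def
    proof (rule runs_Cond)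
      have "output_assortment n (nupdate ''S'' 1 1 ?s) = {1}"
        using True mem by (auto simp: output_assortment_def)
      moreover have "(1 - 2 * \<delta>) * expected_max_load T v S \<le> expected_max_load T v {1}"
        if "S \<subseteq> {1}" for S
      proof (cases "S = {}")
        case True
        then show ?thesis by (simp add: expected_max_load_empty expected_max_load_nonneg)
      next
        case False
        then have "S = {1}" using that by auto
        then show ?thesis using \<delta> expected_max_load_nonneg[of T v S]
          by (simp add: mult_left_le_one_le)
      qed
      ultimately show "runs (NSet ''S'' (NConst 1) (NConst 1)) ?s 3 ?R"
        using True by (intro runs_straight) simp_all
    qed (use True mem in simp)
    moreover have "8 \<le> 8105 * T ^ 3 * n ^ (9 * (m + 1))"
    proof -
      have "1 \<le> T ^ 3" using T by simp
      then show ?thesis using True by simp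
    qed
    ultimately show ?thesis by (elim runs_weaken) simp_all
  next
    case False
    define w where "w i = (if i \<in> {1..n} then v i else 0)" for i
    have w: "0 < w i" if "i \<in> {1..n}" for i using v that by (simp add: w_def)
    have E: "expected_max_load T v S = expected_max_load T w S" if "S \<subseteq> {1..n}" for S
      using that by (intro expected_max_load_cong) (auto simp: w_def)
    have start: "best_so_far T n w ?s"
      using mem by (simp add: best_so_far_def w_def[abs_def] output_assortment_def expected_max_load_empty)
    have "runs (search_prog (m + 1)) ?s (1 + bcost (NLess (nvar ''n'') (NConst 2)) +
        (n + 4) ^ (2 * (m + 1)) * try_cost (m + 1) T n) ?R"
      unfolding search_prog_def
    proof (rule runs_Cond)
      show "runs (nest (2 * (m + 1)) (try_prog (m + 1))) ?s
        ((n + 4) ^ (2 * (m + 1)) * try_cost (m + 1) T n) ?R"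
      proof (rule runs_weaken[OF runs_nest_zero[where T = T and n = n and v = w] order_refl], fact n)
        show "0 < w i" if "i \<in> {1..n}" for i by (rule w[OF that])
        show "best_so_far T n w ?s" by (rule start)
        show "nmem ?s ''x'' = (\<lambda>_. 0)" by (rule mem)
        fix s
        assume s: "\<forall>x. (\<forall>i. x i < n) \<longrightarrow> expected_max_load T w (selected w n (m + 1) x)
            \<le> expected_max_load T w (output_assortment n s)"
        have out: "output_assortment n s \<subseteq> {1..n}" by (auto simp: output_assortment_def)
        show "?R s"
        proof (intro allI impI)
          fix S assume S: "S \<subseteq> {1..n}"
          obtain x where x: "\<forall>k. x k < n" "(1 - 2 * \<delta>) * expected_max_load T w S
              \<le> expected_max_load T w (selected w n (m + 1) x)"
            using near_optimal_interval_union[OF n _ S \<delta>, of w T] w by blast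
          have "expected_max_load T w (selected w n (m + 1) x)
              \<le> expected_max_load T w (output_assortment n s)" using s x(1) by blast
          with x(2) have "(1 - 2 * \<delta>) * expected_max_load T w S
              \<le> expected_max_load T w (output_assortment n s)" by (rule order_trans)
          then show "(1 - 2 * \<delta>) * expected_max_load T v S \<le> expected_max_load T v (output_assortment n s)"
            by (simp only: E[OF S] E[OF out])
        qed
      qed
    qed (use False n mem in simp)
    then show ?thesis
      by (rule runs_weaken) (use search_cost_bound[of n T "m + 1"] False n T in simp_all)
  qed
qed

theorem theorem3p10:
  "\<exists>(K::real) (d::nat) (C::real). \<forall>\<epsilon>::real. 0 < \<epsilon> \<and> \<epsilon> < 1 \<longrightarrow>
     (\<exists>P::com. \<forall>(T::nat) (n::nat) (v::nat \<Rightarrow> real).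
        1 \<le> T \<and> 1 \<le> n \<and> (\<forall>i\<in>{1..n}. 0 < v i) \<longrightarrow>
        (\<exists>(t::nat) (s::memory).
           exec P (input_memory T n v) t s \<and>
           expected_max_load T v (output_assortment n s)
             \<ge> (1 - \<epsilon>) * Max (expected_max_load T v ` Pow {1..n}) \<and>
           real t \<le> K * real T ^ d * real n powr (C * (1 + 1 / \<epsilon> * ln (1 / \<epsilon>)))))"
proof (rule exI[of _ 8105], rule exI[of _ 3], rule exI[of _ 90], intro allI impI)
  fix \<epsilon> :: real assume \<epsilon>: "0 < \<epsilon> \<and> \<epsilon> < 1"
  define m where "m = nat \<lceil>2 / \<epsilon> * ln (2 / \<epsilon>)\<rceil>"
  have m: "(1 - \<epsilon> / 2) ^ m \<le> \<epsilon> / 2" "real m + 1 \<le> 10 * (1 + 1 / \<epsilon> * ln (1 / \<epsilon>))"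
    using class_count_bound[of \<epsilon>] \<epsilon> by (simp_all add: m_def)
  show "\<exists>P::com. \<forall>(T::nat) (n::nat) (v::nat \<Rightarrow> real).
        1 \<le> T \<and> 1 \<le> n \<and> (\<forall>i\<in>{1..n}. 0 < v i) \<longrightarrow>
        (\<exists>(t::nat) (s::memory).
           exec P (input_memory T n v) t s \<and>
           expected_max_load T v (output_assortment n s)
             \<ge> (1 - \<epsilon>) * Max (expected_max_load T v ` Pow {1..n}) \<and>
           real t \<le> 8105 * real T ^ 3 * real n powr (90 * (1 + 1 / \<epsilon> * ln (1 / \<epsilon>))))"
  proof (intro exI[of _ "search_prog (m + 1)"] allI impI)
    fix T n :: nat and v :: "nat \<Rightarrow> real"
    assume *: "1 \<le> T \<and> 1 \<le> n \<and> (\<forall>i\<in>{1..n}. 0 < v i)"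
    have "runs (search_prog (m + 1)) (input_memory T n v) (8105 * T ^ 3 * n ^ (9 * (m + 1)))
      (\<lambda>s. \<forall>S\<subseteq>{1..n}. (1 - 2 * (\<epsilon> / 2)) * expected_max_load T v S
         \<le> expected_max_load T v (output_assortment n s))"
      by (rule runs_search) (use * \<epsilon> m in auto)
    then obtain t s where t: "exec (search_prog (m + 1)) (input_memory T n v) t s"
      "t \<le> 8105 * T ^ 3 * n ^ (9 * (m + 1))"
      "\<And>S. S \<subseteq> {1..n} \<Longrightarrow> (1 - \<epsilon>) * expected_max_load T v S
         \<le> expected_max_load T v (output_assortment n s)"
      by (auto simp: runs_def)
    have "Max (expected_max_load T v ` Pow {1..n}) \<in> expected_max_load T v ` Pow {1..n}"
      by (rule Max_in) auto
    then have max: "(1 - \<epsilon>) * Max (expected_max_load T v ` Pow {1..n})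
      \<le> expected_max_load T v (output_assortment n s)" using t(3) by auto
    have "real t \<le> real (8105 * T ^ 3 * n ^ (9 * (m + 1)))" using t(2) by (simp only: of_nat_le_iff)
    also have "\<dots> = 8105 * real T ^ 3 * real n powr (9 * (real m + 1))"
    proof -
      have "real n powr (9 * (real m + 1)) = real n powr real (9 * (m + 1))"
        by (simp add: add.commute)
      also have "\<dots> = real n ^ (9 * (m + 1))" using * by (intro powr_realpow) simp
      finally show ?thesis by simp
    qed
    also have "\<dots> \<le> 8105 * real T ^ 3 * real n powr (90 * (1 + 1 / \<epsilon> * ln (1 / \<epsilon>)))"
      using * m(2) by (intro mult_left_mono powr_mono) auto
    finally show "\<exists>t s. exec (search_prog (m + 1)) (input_memory T n v) t s \<and>
           expected_max_load T v (output_assortment n s)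
             \<ge> (1 - \<epsilon>) * Max (expected_max_load T v ` Pow {1..n}) \<and>
           real t \<le> 8105 * real T ^ 3 * real n powr (90 * (1 + 1 / \<epsilon> * ln (1 / \<epsilon>)))"
      using t(1) max by blast
  qed
qed

end
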